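(* Let $F$ be a field. The multiplication group of the Moufang loop $M(F)$ is $\Omega(\mathbb O(F),N)$. (Here left and right translations of $M(F)$ by $a\in M(F)$ are identified with the linear maps $x\mapsto ax$, $x\mapsto xa$ of $\mathbb O(F)$.)
   Context: For a field $F$, the split octonion algebra $\mathbb O(F)$ is the Zorn vector matrix algebra: its elements are $\left(\begin{array}{cc}a&\alpha\\ \beta&b\end{array}\right)$ with $a,b\in F$, $\alpha,\beta\in F^3$, added componentwise and multiplied by $$\left(\begin{array}{cc}a&\alpha\\ \beta&b\end{array}\right)\left(\begin{array}{cc}c&\gamma\\ \delta&d\end{array}\right)=\left(\begin{array}{cc}ac+\alpha\cdot\delta& a\gamma+d\alpha-\beta\times\delta\\ c\beta+b\delta+\alpha\times\gamma&\beta\cdot\gamma+bd\end{array}\right),$$ with the usual dot and cross products on $F^3$. The norm $N$ is $\left(\begin{array}{cc}a&\alpha\\ \beta&b\end{array}\right)\mapsto ab-\alpha\cdot\beta$, a non-degenerate multiplicative quadratic form. $M(F)$ is the Moufang loop of all elements of norm $1$ in $\mathbb O(F)$. The multiplication group $\mathrm{Mlt}(Q)$ of a loop $Q$ is the permutation group generated by all left translations $L_x:y\mapsto xy$ and right translations $R_x:y\mapsto yx$, $x\in Q$. For a vector space $V$ with non-degenerate quadratic form $N$, $O(V,N)$ is the group of linear transformations preserving $N$, and $\Omega(V,N)$ is the commutator subgroup of $O(V,N)$. *)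

theory Defs
  imports "HOL-Analysis.Cartesian_Space" "HOL-Algebra.Bij" "HOL-Algebra.Generated_Groups"
begin

section \<open>Split octonions as Zorn vector matrices\<close>

(* HOL-Analysis has the cross product for real^3 only. *)
definition cross_prod :: "'a::comm_ring_1 ^ 3 \<Rightarrow> 'a ^ 3 \<Rightarrow> 'a ^ 3" where
  "cross_prod a b = vector
     [a $ 2 * b $ 3 - a $ 3 * b $ 2,
      a $ 3 * b $ 1 - a $ 1 * b $ 3,
      a $ 1 * b $ 2 - a $ 2 * b $ 1]"

(* Zorn a \<alpha> \<beta> b is the matrix with rows (a, \<alpha>) and (\<beta>, b). *)
datatype 'a octonion = Zorn 'a "'a ^ 3" "'a ^ 3" 'a

instantiation octonion :: (field) ab_group_add
begin

definition zero_octonion :: "'a octonion" where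
  "zero_octonion = Zorn 0 0 0 0"

fun plus_octonion :: "'a octonion \<Rightarrow> 'a octonion \<Rightarrow> 'a octonion" where
  "plus_octonion (Zorn a \<alpha> \<beta> b) (Zorn c \<gamma> \<delta> d) = Zorn (a + c) (\<alpha> + \<gamma>) (\<beta> + \<delta>) (b + d)"

fun minus_octonion :: "'a octonion \<Rightarrow> 'a octonion \<Rightarrow> 'a octonion" where
  "minus_octonion (Zorn a \<alpha> \<beta> b) (Zorn c \<gamma> \<delta> d) = Zorn (a - c) (\<alpha> - \<gamma>) (\<beta> - \<delta>) (b - d)"

fun uminus_octonion :: "'a octonion \<Rightarrow> 'a octonion" where
  "uminus_octonion (Zorn a \<alpha> \<beta> b) = Zorn (- a) (- \<alpha>) (- \<beta>) (- b)"

instance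
proof
  fix x y z :: "'a octonion"
  show "x + y + z = x + (y + z)"
    by (cases x; cases y; cases z) (simp add: add.assoc)
  show "x + y = y + x"
    by (cases x; cases y) (simp add: add.commute)
  show "0 + x = x"
    by (cases x) (simp add: zero_octonion_def)
  show "- x + x = 0"
    by (cases x) (simp add: zero_octonion_def)
  show "x - y = x + - y"
    by (cases x; cases y) simp
qed

end

instantiation octonion :: (field) "{one, times}"
begin

definition one_octonion :: "'a octonion" where
  "one_octonion = Zorn 1 0 0 1"

fun times_octonion :: "'a octonion \<Rightarrow> 'a octonion \<Rightarrow> 'a octonion" where
  "times_octonion (Zorn a \<alpha> \<beta> b) (Zorn c \<gamma> \<delta> d) =
     Zorn (a * c + scalar_product \<alpha> \<delta>)
          (a *s \<gamma> + d *s \<alpha> - cross_prod \<beta> \<delta>)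
          (c *s \<beta> + b *s \<delta> + cross_prod \<alpha> \<gamma>)
          (scalar_product \<beta> \<gamma> + b * d)"

instance ..

end

fun oct_scale :: "'a::field \<Rightarrow> 'a octonion \<Rightarrow> 'a octonion" where
  "oct_scale r (Zorn a \<alpha> \<beta> b) = Zorn (r * a) (r *s \<alpha>) (r *s \<beta>) (r * b)"

interpretation octonion: vector_space "oct_scale :: 'a::field \<Rightarrow> 'a octonion \<Rightarrow> 'a octonion"
proof
  fix r s :: 'a and x y :: "'a octonion"
  show "oct_scale r (x + y) = oct_scale r x + oct_scale r y"
    by (cases x; cases y) (simp add: distrib_left vec.scale_right_distrib)
  show "oct_scale (r + s) x = oct_scale r x + oct_scale s x"
    by (cases x) (simp add: distrib_right vec.scale_left_distrib)
  show "oct_scale r (oct_scale s x) = oct_scale (r * s) x"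
    by (cases x) (simp add: mult.assoc)
  show "oct_scale 1 x = x"
    by (cases x) simp
qed

fun oct_norm :: "'a::field octonion \<Rightarrow> 'a" where
  "oct_norm (Zorn a \<alpha> \<beta> b) = a * b - scalar_product \<alpha> \<beta>"

lemma oct_norm_mult: "oct_norm (x * y) = oct_norm x * oct_norm y"
  by (cases x; cases y)
     (simp add: scalar_product_def cross_prod_def sum_3 algebra_simps)

lemma oct_mult_one [simp]: "1 * x = x" "x * 1 = (x :: 'a::field octonion)"
  by (cases x; simp add: one_octonion_def scalar_product_def cross_prod_def
        vec_eq_iff forall_3)+

(* A loop is given as a monoid record, of which only the signature is used:
   associativity is not required. *)
definition octonion_loop :: "'a::field octonion monoid" where
  "octonion_loop = \<lparr>carrier = {x. oct_norm x = 1}, mult = (*), one = 1\<rparr>"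


section \<open>Multiplication groups and orthogonal groups\<close>

(* BijGroup requires permutations of the carrier to be extensional. *)
definition left_translation :: "('a, 'b) monoid_scheme \<Rightarrow> 'a \<Rightarrow> 'a \<Rightarrow> 'a" where
  "left_translation Q x = (\<lambda>y \<in> carrier Q. x \<otimes>\<^bsub>Q\<^esub> y)"

definition right_translation :: "('a, 'b) monoid_scheme \<Rightarrow> 'a \<Rightarrow> 'a \<Rightarrow> 'a" where
  "right_translation Q x = (\<lambda>y \<in> carrier Q. y \<otimes>\<^bsub>Q\<^esub> x)"

definition Mlt :: "('a, 'b) monoid_scheme \<Rightarrow> ('a \<Rightarrow> 'a) monoid" where
  "Mlt Q = BijGroup (carrier Q)
     \<lparr>carrier := generate (BijGroup (carrier Q))
        (left_translation Q ` carrier Q \<union> right_translation Q ` carrier Q)\<rparr>"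

(* The vector space is the whole type, with scalar multiplication scl;
   BijGroup UNIV is the group of all its permutations under composition. *)
definition orthogonal_group ::
    "('k::field \<Rightarrow> 'v::ab_group_add \<Rightarrow> 'v) \<Rightarrow> ('v \<Rightarrow> 'k) \<Rightarrow> ('v \<Rightarrow> 'v) monoid" where
  "orthogonal_group scl N = BijGroup UNIV
     \<lparr>carrier := {f. Vector_Spaces.linear scl scl f \<and> bij f \<and> (\<forall>x. N (f x) = N x)}\<rparr>"

definition Omega ::
    "('k::field \<Rightarrow> 'v::ab_group_add \<Rightarrow> 'v) \<Rightarrow> ('v \<Rightarrow> 'k) \<Rightarrow> ('v \<Rightarrow> 'v) monoid" where
  "Omega scl N = (orthogonal_group scl N)
     \<lparr>carrier := derived (orthogonal_group scl N) (carrier (orthogonal_group scl N))\<rparr>"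

end

theory Submission
  imports Defs
begin

text \<open>
Over every field, the split octonions with their norm are an orthogonal sum of four hyperbolic
planes. Choose a basis \<open>e\<^sub>k\<close> with \<open>k \<in> {\<plusminus>1, ..., \<plusminus>4}\<close> such that \<open>e\<^sub>k\<close> and \<open>e\<^sub>l\<close> are paired to 1
if \<open>l = - k\<close> and to 0 otherwise. The root elements
\<open>x\<^sub>k\<^sub>l(t) : x \<mapsto> x + t B(x, e\<^sub>l) e\<^sub>k - t B(x, e\<^sub>k) e\<^sub>l\<close> with \<open>\<bar>k\<bar> \<noteq> \<bar>l\<bar>\<close> are isometries, and the proof compares
both sides of the theorem with the group \<open>E\<close> that they generate.

\<^bold>\<open>The commutator subgroup is \<open>E\<close>.\<close> With at least three planes, every root element is a commutator of
two root elements (\<open>root_commutator\<close>), so \<open>E\<close> lies in the commutator subgroup. Conversely, Gaussian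
elimination with root elements moves any hyperbolic pair to any basis pair, and by induction over
the planes every isometry becomes, modulo \<open>E\<close>, an isometry supported on one plane, which may be
prescribed (\<open>orth_decomposition\<close>). Isometries supported on two different planes commute, and they
normalize \<open>E\<close> because they permute the lines spanned by basis vectors. Reducing \<open>f\<close> to one plane and
\<open>g\<close> to another therefore puts the commutator of \<open>f\<close> and \<open>g\<close> into \<open>E\<close>. This avoids reflections and
spinor norms, and it is uniform in the characteristic.

\<^bold>\<open>The translations lie in \<open>E\<close>.\<close> The octonions of norm 1 are generated by the elements with diagonal
\<open>(1, 1)\<close> and one vanishing off-diagonal vector (\<open>unit_octonion_induct\<close>). Translation by such an element
is visibly a product of root elements. By the Moufang identity, the translations by a product lie in
any group that contains the translations by its factors (\<open>unit_translations_mem\<close>).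

\<^bold>\<open>\<open>E\<close> lies in the group of translations.\<close> The translations provide the root elements only in coupled
pairs, such as \<open>x\<^sub>1\<^sub>,\<^sub>4(t) x\<^sub>-\<^sub>2\<^sub>,\<^sub>-\<^sub>3(t)\<close>. Commutators of such pairs separate the factors, again in every
characteristic (\<open>root_commutator_pair\<close>, \<open>root_isolation\<close>).

Finally, the elements of norm 1 span the space, so an isometry is determined by its restriction to
the loop. Restriction is a homomorphism of permutation groups which maps the linear translations to
the translations of the loop, hence one generated group onto the other.
\<close>

section \<open>Groups of permutations of a type\<close>

lemma carrier_BijGroup_UNIV: "carrier (BijGroup UNIV) = {f. bij f}"
  by (auto simp: BijGroup_def Bij_def)

lemma mult_BijGroup_UNIV:
  assumes "bij f" "bij g"
  shows "f \<otimes>\<^bsub>BijGroup UNIV\<^esub> g = f \<circ> g"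
  using assms by (auto simp: BijGroup_def Bij_def compose_def fun_eq_iff)

lemma one_BijGroup_UNIV: "\<one>\<^bsub>BijGroup UNIV\<^esub> = id"
  by (auto simp: BijGroup_def)

lemma inv_BijGroup_UNIV: "bij f \<Longrightarrow> inv\<^bsub>BijGroup UNIV\<^esub> f = Hilbert_Choice.inv f"
  by (subst inv_BijGroup) (auto simp: Bij_def)

lemma permutation_subgroupI:
  assumes "\<And>f. f \<in> H \<Longrightarrow> bij f" and "id \<in> H"
    and "\<And>f g. f \<in> H \<Longrightarrow> g \<in> H \<Longrightarrow> f \<circ> g \<in> H"
    and "\<And>f. f \<in> H \<Longrightarrow> Hilbert_Choice.inv f \<in> H"
  shows "subgroup H (BijGroup UNIV)"
  using assms
  by unfold_locales
    (auto simp: carrier_BijGroup_UNIV mult_BijGroup_UNIV one_BijGroup_UNIV inv_BijGroup_UNIV)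

text \<open>
Membership in a group of permutations, phrased with composition and inverse of functions in place
of the record operations of \<^term>\<open>BijGroup UNIV\<close>.
\<close>
locale permutation_subgroup =
  fixes H :: "('a \<Rightarrow> 'a) set"
  assumes subgroup_H: "subgroup H (BijGroup UNIV)"
begin

lemma bij: "f \<in> H \<Longrightarrow> bij f"
  using subgroup.subset[OF subgroup_H] by (auto simp: carrier_BijGroup_UNIV)

lemma id_mem: "id \<in> H"
  using subgroup.one_closed[OF subgroup_H] by (simp add: one_BijGroup_UNIV)

lemma comp_mem: "f \<in> H \<Longrightarrow> g \<in> H \<Longrightarrow> f \<circ> g \<in> H"
  using subgroup.m_closed[OF subgroup_H, of f g] by (simp add: mult_BijGroup_UNIV bij)

lemma inv_mem: "f \<in> H \<Longrightarrow> Hilbert_Choice.inv f \<in> H"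
  using subgroup.m_inv_closed[OF subgroup_H, of f] by (simp add: inv_BijGroup_UNIV bij)

lemma cancel_left:
  assumes "f \<in> H" "f \<circ> g \<in> H"
  shows "g \<in> H"
proof -
  have "Hilbert_Choice.inv f \<circ> (f \<circ> g) \<in> H" by (rule comp_mem[OF inv_mem[OF assms(1)] assms(2)])
  moreover have "Hilbert_Choice.inv f \<circ> (f \<circ> g) = g"
    using bij[OF assms(1)] by (auto simp: fun_eq_iff bij_is_inj)
  ultimately show ?thesis by simp
qed

lemma cancel_right:
  assumes "g \<in> H" "f \<circ> g \<in> H"
  shows "f \<in> H"
proof -
  have "(f \<circ> g) \<circ> Hilbert_Choice.inv g \<in> H" by (rule comp_mem[OF assms(2) inv_mem[OF assms(1)]])
  moreover have "(f \<circ> g) \<circ> Hilbert_Choice.inv g = f"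
    using bij[OF assms(1)] by (auto simp: fun_eq_iff bij_is_surj surj_f_inv_f)
  ultimately show ?thesis by simp
qed

lemma generate_subset: "S \<subseteq> H \<Longrightarrow> generate (BijGroup UNIV) S \<subseteq> H"
  by (rule group.generate_subgroup_incl[OF group_BijGroup _ subgroup_H])

lemma conjugate_subgroup:
  fixes f :: "'a \<Rightarrow> 'a"
  assumes f: "bij f"
  shows "permutation_subgroup {g. bij g \<and> f \<circ> g \<circ> Hilbert_Choice.inv f \<in> H}"
proof (rule permutation_subgroup.intro, rule permutation_subgroupI)
  let ?c = "\<lambda>g. f \<circ> g \<circ> Hilbert_Choice.inv f"
  have inv_f: "Hilbert_Choice.inv f (f x) = x" "f (Hilbert_Choice.inv f x) = x" for x
    using f by (simp_all add: bij_is_inj bij_is_surj surj_f_inv_f)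
  show "id \<in> {g. bij g \<and> ?c g \<in> H}"
    using id_mem by (simp add: comp_def inv_f id_def bij_id[unfolded id_def])
  fix g assume g: "g \<in> {g. bij g \<and> ?c g \<in> H}"
  then show "bij g" by simp
  have inv_g: "Hilbert_Choice.inv g (g x) = x" "g (Hilbert_Choice.inv g x) = x" for x
    using g by (simp_all add: bij_is_inj bij_is_surj surj_f_inv_f)
  have "Hilbert_Choice.inv (?c g) = ?c (Hilbert_Choice.inv g)"
    by (rule inv_equality) (simp_all add: inv_f inv_g)
  then show "Hilbert_Choice.inv g \<in> {g. bij g \<and> ?c g \<in> H}"
    using g inv_mem[of "?c g"] by (simp add: bij_imp_bij_inv)
  fix g' assume g': "g' \<in> {g. bij g \<and> ?c g \<in> H}"
  have "?c g \<circ> ?c g' = ?c (g \<circ> g')" by (simp add: fun_eq_iff inv_f)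
  then show "g \<circ> g' \<in> {g. bij g \<and> ?c g \<in> H}"
    using g g' comp_mem[of "?c g" "?c g'"] by (auto intro: bij_comp)
qed

end

lemma permutation_subgroup_generate:
  assumes "\<And>f. f \<in> S \<Longrightarrow> bij f"
  shows "permutation_subgroup (generate (BijGroup UNIV) S)"
  using assms
  by (auto simp: permutation_subgroup_def carrier_BijGroup_UNIV
      intro!: group.generate_is_subgroup[OF group_BijGroup])

lemma generate_conjugate_closed:
  fixes f :: "'a \<Rightarrow> 'a"
  assumes H: "permutation_subgroup H" and f: "bij f"
    and S: "\<And>g. g \<in> S \<Longrightarrow> bij g" "\<And>g. g \<in> S \<Longrightarrow> f \<circ> g \<circ> Hilbert_Choice.inv f \<in> H"
    and g: "g \<in> generate (BijGroup UNIV) S"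
  shows "f \<circ> g \<circ> Hilbert_Choice.inv f \<in> H"
  using permutation_subgroup.generate_subset[OF permutation_subgroup.conjugate_subgroup[OF H f], of S] S g
  by auto

section \<open>Hyperbolic quadratic spaces\<close>

text \<open>
An orthogonal sum of \<open>n\<close> hyperbolic planes. The \<open>k\<close>-th plane is spanned by the singular vectors
\<open>b k\<close> and \<open>b (- k)\<close>, so the coordinate of \<open>x\<close> at \<open>b k\<close> is \<open>B x (b (- k))\<close>. Signed integers as
indices match the usual names of the weights of the orthogonal group: the root element with indices
\<open>k\<close> and \<open>l\<close> belongs to the sum of the weights \<open>k\<close> and \<open>l\<close>. The form \<open>B\<close> is the polar form, and \<open>N\<close> is
kept separate from it so that characteristic 2 is covered.
\<close>
locale hyperbolic_space = vector_space scl
  for scl :: "'k::field \<Rightarrow> 'v::ab_group_add \<Rightarrow> 'v" +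
  fixes N :: "'v \<Rightarrow> 'k" and B :: "'v \<Rightarrow> 'v \<Rightarrow> 'k" and n :: int and b :: "int \<Rightarrow> 'v"
  assumes N_add: "N (x + y) = N x + N y + B x y"
    and N_scale: "N (scl c x) = c * c * N x"
    and B_add_left: "B (x + y) z = B x z + B y z"
    and B_scale_left: "B (scl c x) z = c * B x z"
    and N_basis: "N (b k) = 0"
    and B_basis: "1 \<le> \<bar>k\<bar> \<Longrightarrow> \<bar>k\<bar> \<le> n \<Longrightarrow> 1 \<le> \<bar>l\<bar> \<Longrightarrow> \<bar>l\<bar> \<le> n \<Longrightarrow>
      B (b k) (b l) = (if l = - k then 1 else 0)"
    and basis_expansion: "x = (\<Sum>k\<in>{k. 1 \<le> \<bar>k\<bar> \<and> \<bar>k\<bar> \<le> n}. scl (B x (b (- k))) (b k))"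
begin

definition idx :: "int set" where
  "idx = {k. 1 \<le> \<bar>k\<bar> \<and> \<bar>k\<bar> \<le> n}"

definition root_elt :: "'k \<Rightarrow> int \<Rightarrow> int \<Rightarrow> 'v \<Rightarrow> 'v" where
  "root_elt t k l x = x + scl (t * B x (b l)) (b k) - scl (t * B x (b k)) (b l)"

definition orth :: "('v \<Rightarrow> 'v) set" where
  "orth = {f. Vector_Spaces.linear scl scl f \<and> bij f \<and> (\<forall>x. N (f x) = N x)}"

text \<open>
In \<open>roots A\<close> and \<open>Elem A\<close> only the planes whose (positive) index lies in \<open>A\<close> are moved. The
elimination below needs this to leave alone the planes that it has already dealt with.
\<close>
definition roots :: "int set \<Rightarrow> ('v \<Rightarrow> 'v) set" where
  "roots A = {root_elt t k l | t k l. k \<in> idx \<and> l \<in> idx \<and> \<bar>k\<bar> \<noteq> \<bar>l\<bar> \<and> \<bar>k\<bar> \<in> A \<and> \<bar>l\<bar> \<in> A}"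

definition Elem :: "int set \<Rightarrow> ('v \<Rightarrow> 'v) set" where
  "Elem A = generate (BijGroup UNIV) (roots A)"

lemma finite_idx: "finite idx"
  by (rule finite_subset[of _ "{-n..n}"]) (auto simp: idx_def)

lemma minus_idx [simp]: "- k \<in> idx \<longleftrightarrow> k \<in> idx"
  by (auto simp: idx_def)

lemma zero_notin_idx: "0 \<notin> idx"
  by (auto simp: idx_def)

lemma B_commute: "B x y = B y x"
proof -
  have "N (x + y) = N (y + x)" by (simp add: add.commute)
  then show ?thesis by (simp add: N_add)
qed

lemma B_add_right: "B x (y + z) = B x y + B x z"
  using B_add_left by (metis B_commute)

lemma B_scale_right: "B x (scl c y) = c * B x y"
  using B_scale_left by (metis B_commute)

lemma B_minus_left: "B (- x) y = - B x y"
  using B_scale_left[of "-1" x y] by simp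

lemma B_minus_right: "B x (- y) = - B x y"
  using B_minus_left by (metis B_commute)

lemma B_diff_left: "B (x - y) z = B x z - B y z"
  using B_add_left[of x "- y" z] by (simp add: B_minus_left)

lemma B_diff_right: "B x (y - z) = B x y - B x z"
  using B_diff_left by (metis B_commute)

lemma N_diff: "N (x - y) = N x + N y - B x y"
  using N_add[of x "- y"] N_scale[of "-1" y] by (simp add: B_minus_right)

lemmas bilinear = B_add_left B_add_right B_scale_left B_scale_right B_diff_left B_diff_right
  B_minus_left B_minus_right

lemma B_basis': "k \<in> idx \<Longrightarrow> l \<in> idx \<Longrightarrow> B (b k) (b l) = (if l = - k then 1 else 0)"
  using B_basis by (auto simp: idx_def)

lemma basis_sum: "(\<Sum>k\<in>idx. scl (B x (b (- k))) (b k)) = x"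
  using basis_expansion[of x] by (simp add: idx_def)

lemma eq_zeroI:
  assumes "\<And>k. k \<in> idx \<Longrightarrow> B x (b k) = 0"
  shows "x = 0"
proof -
  have "x = (\<Sum>k\<in>idx. scl (B x (b (- k))) (b k))" by (simp add: basis_sum)
  also have "\<dots> = 0" by (rule sum.neutral) (simp add: assms)
  finally show ?thesis .
qed

lemma eqI:
  assumes "\<And>k. k \<in> idx \<Longrightarrow> B x (b k) = B y (b k)"
  shows "x = y"
  using eq_zeroI[of "x - y"] assms by (simp add: B_diff_left)

lemma linear_ext:
  assumes "Vector_Spaces.linear scl scl f" "Vector_Spaces.linear scl scl g"
    and "\<And>k. k \<in> idx \<Longrightarrow> f (b k) = g (b k)"
  shows "f = g"
proof
  fix x
  interpret f: Vector_Spaces.linear scl scl f by fact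
  interpret g: Vector_Spaces.linear scl scl g by fact
  have "f (\<Sum>k\<in>idx. scl (B x (b (- k))) (b k)) = g (\<Sum>k\<in>idx. scl (B x (b (- k))) (b k))"
    by (simp add: f.sum g.sum f.scale g.scale assms(3))
  then show "f x = g x" by (simp add: basis_sum)
qed

section \<open>The orthogonal group\<close>

lemma orth_linear: "f \<in> orth \<Longrightarrow> Vector_Spaces.linear scl scl f"
  and orth_bij: "f \<in> orth \<Longrightarrow> bij f"
  and orth_N: "f \<in> orth \<Longrightarrow> N (f x) = N x"
  by (auto simp: orth_def)

lemma orth_add: "f \<in> orth \<Longrightarrow> f (x + y) = f x + f y"
  and orth_scale: "f \<in> orth \<Longrightarrow> f (scl c x) = scl c (f x)"
  and orth_diff: "f \<in> orth \<Longrightarrow> f (x - y) = f x - f y"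
  using orth_linear[of f]
  by (simp_all add: Vector_Spaces.linear.axioms module_hom.add module_hom.scale module_hom.diff linear_iff_module_hom)

lemma orth_B:
  assumes "f \<in> orth"
  shows "B (f x) (f y) = B x y"
proof -
  have "N (f (x + y)) = N (x + y)" by (rule orth_N[OF assms])
  then show ?thesis by (simp add: orth_add[OF assms] N_add orth_N[OF assms])
qed

lemma orth_subgroup: "permutation_subgroup orth"
proof (rule permutation_subgroup.intro, rule permutation_subgroupI)
  show "id \<in> orth" by (simp add: orth_def linear_id)
  fix f g assume f: "f \<in> orth" 
  show "bij f" by (rule orth_bij[OF f])
  { assume g: "g \<in> orth"
    show "f \<circ> g \<in> orth"
      using f g by (auto simp: orth_def intro: bij_comp Vector_Spaces.linear_compose) }
  have *: "f (Hilbert_Choice.inv f x) = x" for x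
    using orth_bij[OF f] by (simp add: bij_is_surj surj_f_inv_f)
  have "Vector_Spaces.linear scl scl (Hilbert_Choice.inv f)"
    using bij_is_inj[OF orth_bij[OF f]] bij_is_surj[OF orth_bij[OF f]] orth_linear[OF f]
    by (intro Vector_Spaces.linear_iff[THEN iffD2])
      (auto simp: vector_space_axioms orth_add[OF f] orth_scale[OF f] * intro!: inv_f_eq)
  moreover have "N (Hilbert_Choice.inv f x) = N x" for x
    using orth_N[OF f, of "Hilbert_Choice.inv f x"] by (simp add: *)
  ultimately show "Hilbert_Choice.inv f \<in> orth"
    using orth_bij[OF f] by (simp add: orth_def bij_imp_bij_inv)
qed

sublocale orth: permutation_subgroup orth
  by (rule orth_subgroup)

text \<open>
The vectors of norm 1 span the space: if \<open>w\<close> is the sum of the two basis vectors of a plane that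
does not contain \<open>b k\<close>, then \<open>w\<close> and \<open>w + b k\<close> have norm 1.
\<close>
lemma orth_eq_if_eq_on_unit_sphere:
  assumes n: "2 \<le> n" and f: "f \<in> orth" and g: "g \<in> orth"
    and eq: "\<And>x. N x = 1 \<Longrightarrow> f x = g x"
  shows "f = g"
proof (rule linear_ext[OF orth_linear[OF f] orth_linear[OF g]])
  fix k assume k: "k \<in> idx"
  have "\<exists>j\<in>{1, 2}. j \<noteq> \<bar>k\<bar>" by auto
  then obtain j where "j \<in> {1, 2}" "j \<noteq> \<bar>k\<bar>" by blast
  then have j: "j \<in> idx" "j \<noteq> k" "j \<noteq> - k" "k \<noteq> - j" "k \<noteq> j" using n by (auto simp: idx_def)
  define w where "w = b j + b (- j)"
  have "N w = 1" "N (w + b k) = 1"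
    using j k by (simp_all add: w_def N_add N_basis bilinear B_basis')
  then have "f (w + b k) - f w = g (w + b k) - g w" by (simp add: eq)
  then show "f (b k) = g (b k)" by (simp add: orth_add[OF f] orth_add[OF g])
qed

section \<open>Root elements\<close>

lemma linear_root: "Vector_Spaces.linear scl scl (root_elt t k l)"
  by (rule Vector_Spaces.linear_iff[THEN iffD2])
    (auto simp: vector_space_axioms root_elt_def bilinear algebra_simps)

lemma root_add:
  assumes "k \<in> idx" "l \<in> idx" "\<bar>k\<bar> \<noteq> \<bar>l\<bar>"
  shows "root_elt s k l (root_elt t k l x) = root_elt (s + t) k l x"
  using assms zero_notin_idx by (auto simp: root_elt_def bilinear B_basis' algebra_simps)

lemma root_zero: "root_elt 0 k l = id"
  by (auto simp: root_elt_def)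

lemma root_swap: "root_elt t k l = root_elt (- t) l k"
  by (auto simp: root_elt_def algebra_simps)

lemma bij_root:
  assumes "k \<in> idx" "l \<in> idx" "\<bar>k\<bar> \<noteq> \<bar>l\<bar>"
  shows "bij (root_elt t k l)"
  by (rule o_bij[of "root_elt (- t) k l"]) (auto simp: fun_eq_iff root_add[OF assms] root_zero)

lemma inv_root:
  assumes "k \<in> idx" "l \<in> idx" "\<bar>k\<bar> \<noteq> \<bar>l\<bar>"
  shows "Hilbert_Choice.inv (root_elt t k l) = root_elt (- t) k l"
  by (rule inv_equality) (auto simp: root_add[OF assms] root_zero)

lemma root_orth:
  assumes "k \<in> idx" "l \<in> idx" "\<bar>k\<bar> \<noteq> \<bar>l\<bar>"
  shows "root_elt t k l \<in> orth"
proof -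
  have "N (root_elt t k l x) = N x" for x
    using assms zero_notin_idx
    by (auto simp: root_elt_def N_add N_diff N_scale bilinear B_basis' N_basis algebra_simps)
  then show ?thesis by (simp add: orth_def linear_root bij_root[OF assms])
qed

lemma roots_subset_orth: "roots A \<subseteq> orth"
  by (auto simp: roots_def root_orth)

lemma Elem_subset_orth: "Elem A \<subseteq> orth"
  unfolding Elem_def by (rule orth.generate_subset[OF roots_subset_orth])

lemma Elem_subgroup: "permutation_subgroup (Elem A)"
  unfolding Elem_def by (rule permutation_subgroup_generate) (auto simp: roots_def bij_root)

lemma root_Elem:
  assumes "k \<in> idx" "l \<in> idx" "\<bar>k\<bar> \<noteq> \<bar>l\<bar>" "\<bar>k\<bar> \<in> A" "\<bar>l\<bar> \<in> A"
  shows "root_elt t k l \<in> Elem A"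
  unfolding Elem_def using assms by (auto simp: roots_def intro!: generate.incl)

lemma Elem_mono: "A \<subseteq> A' \<Longrightarrow> Elem A \<subseteq> Elem A'"
  unfolding Elem_def by (rule group.mono_generate[OF group_BijGroup]) (auto simp: roots_def)

text \<open>
The commutator relation for two roots whose sum is a root. A third plane \<open>m\<close> lets it produce every
root element, which is the reason why three planes are needed for the perfectness of the group of
root elements.
\<close>
lemma root_commutator:
  assumes "k \<in> idx" "l \<in> idx" "m \<in> idx" "\<bar>k\<bar> \<noteq> \<bar>l\<bar>" "\<bar>k\<bar> \<noteq> \<bar>m\<bar>" "\<bar>l\<bar> \<noteq> \<bar>m\<bar>"
  shows "root_elt t k m \<circ> root_elt s (- m) l \<circ> root_elt (- t) k m \<circ> root_elt (- s) (- m) l =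
    root_elt (t * s) k l"
proof
  fix x
  have "k \<noteq> 0" "l \<noteq> 0" "m \<noteq> 0" "k \<noteq> l" "k \<noteq> m" "l \<noteq> m" "l \<noteq> k" "m \<noteq> k" "m \<noteq> l"
     "k \<noteq> -l" "k \<noteq> -m" "l \<noteq> -m" "l \<noteq> -k" "m \<noteq> -k" "m \<noteq> -l"
    using assms zero_notin_idx by auto
  then show "(root_elt t k m \<circ> root_elt s (- m) l \<circ> root_elt (- t) k m \<circ> root_elt (- s) (- m) l) x =
      root_elt (t * s) k l x"
    using assms by (simp add: root_elt_def bilinear B_basis' algebra_simps)
qed

section \<open>Elimination in the orthogonal group\<close>
definition fixing :: "'v set \<Rightarrow> ('v \<Rightarrow> 'v) set" where
  "fixing X = {f \<in> orth. \<forall>x\<in>X. f x = x}"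

lemma fixing_subgroup: "permutation_subgroup (fixing X)"
proof (rule permutation_subgroup.intro, rule permutation_subgroupI)
  fix f assume f: "f \<in> fixing X"
  then have fo: "f \<in> orth" by (simp add: fixing_def)
  then show "bij f" by (rule orth_bij)
  show "Hilbert_Choice.inv f \<in> fixing X"
    using f orth.inv_mem[OF fo] bij_is_inj[OF orth_bij[OF fo]]
    by (auto simp: fixing_def intro!: inv_f_eq)
qed (auto simp: fixing_def orth.id_mem orth.comp_mem)

lemma Elem_fixes_basis:
  assumes "h \<in> Elem A" "k \<in> idx" "\<bar>k\<bar> \<notin> A"
  shows "h (b k) = b k"
proof -
  interpret F: permutation_subgroup "fixing {b k}" by (rule fixing_subgroup)
  have "roots A \<subseteq> fixing {b k}"
    using assms(2,3) roots_subset_orth[of A]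
    by (auto simp: fixing_def roots_def root_elt_def B_basis')
  then have "Elem A \<subseteq> fixing {b k}" unfolding Elem_def by (rule F.generate_subset)
  then show ?thesis using assms(1) by (auto simp: fixing_def)
qed

lemma B_root:
  "B (root_elt t k l x) y = B x y + t * B x (b l) * B (b k) y - t * B x (b k) * B (b l) y"
  by (simp add: root_elt_def bilinear)

text \<open>
Once the coordinate at \<open>b j\<close> is 1, it serves as a pivot: root elements that add multiples of it
clear the coordinates in the other planes one at a time. They change otherwise only the coordinate
at \<open>b (- j)\<close>, which must vanish in the end because the vector is singular. All of them fix \<open>b (- j)\<close>;
this is what allows a second use, with \<open>- j\<close> in place of \<open>j\<close>, that does not destroy the first.
\<close>
lemma Elem_clear_coordinates:
  assumes j: "j \<in> idx" "\<bar>j\<bar> \<in> A" and N: "N x = 0" and one: "B x (b (- j)) = 1"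
    and supp: "\<And>k. k \<in> idx \<Longrightarrow> \<bar>k\<bar> \<notin> A \<Longrightarrow> B x (b k) = 0"
  shows "\<exists>h\<in>Elem A. h x = b j \<and> h (b (- j)) = b (- j)"
proof -
  interpret E: permutation_subgroup "Elem A" by (rule Elem_subgroup)
  define D where "D = {k \<in> idx. \<bar>k\<bar> \<in> A \<and> \<bar>k\<bar> \<noteq> \<bar>j\<bar>}"
  have "finite D" unfolding D_def using finite_idx by simp
  have "\<exists>h\<in>Elem A. h (b (- j)) = b (- j) \<and> (\<forall>k\<in>F. B (h x) (b k) = 0)"
    if "finite F" "F \<subseteq> D" for F
    using that
  proof (induction F)
    case empty
    show ?case by (intro bexI[of _ id]) (auto simp: E.id_mem)
  next
    case (insert k F)
    then obtain h where h: "h \<in> Elem A" "h (b (- j)) = b (- j)" "\<forall>k\<in>F. B (h x) (b k) = 0"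
      by auto
    have k: "k \<in> idx" "\<bar>k\<bar> \<in> A" "\<bar>k\<bar> \<noteq> \<bar>j\<bar>" using insert.prems by (auto simp: D_def)
    \<comment> \<open>The coordinate paired with \<open>b k\<close> sits at \<open>b (- k)\<close>; the pivot is 1, so the factor is its negative.\<close>
    let ?g = "root_elt (- B (h x) (b k)) (- k) (- j)"
    have g: "?g \<in> Elem A" using j k by (intro root_Elem) auto
    have B1: "B (h x) (b (- j)) = 1"
      using orth_B[of h x "b (- j)"] h(1,2) Elem_subset_orth[of A] one by auto
    have "?g (b (- j)) = b (- j)"
      using j k zero_notin_idx by (auto simp: root_elt_def B_basis')
    moreover have "B (?g (h x)) (b m) = 0" if "m \<in> insert k F" for m
    proof -
      have m: "m \<in> idx" "\<bar>m\<bar> \<noteq> \<bar>j\<bar>" using that insert.prems by (auto simp: D_def)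
      have *: "m = k \<or> m \<noteq> k \<and> B (h x) (b m) = 0" using that h(3) by auto
      show ?thesis using j k m * by (auto simp: B_root B1 B_basis')
    qed
    ultimately show ?case
      using E.comp_mem[OF g h(1)] h(2) by (intro bexI[of _ "?g \<circ> h"]) auto
  qed
  then obtain h where h: "h \<in> Elem A" "h (b (- j)) = b (- j)" "\<forall>k\<in>D. B (h x) (b k) = 0"
    using \<open>finite D\<close> by blast
  have ho: "h \<in> orth" using h(1) Elem_subset_orth by auto
  have B1: "B (h x) (b (- j)) = 1"
    using orth_B[OF ho, of x "b (- j)"] h(2) one by auto
  have B0: "B (h x) (b k) = 0" if "k \<in> idx" "\<bar>k\<bar> \<noteq> \<bar>j\<bar>" for k
  proof (cases "\<bar>k\<bar> \<in> A")
    case True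
    then show ?thesis using h(3) that by (auto simp: D_def)
  next
    case False
    then show ?thesis
      using orth_B[OF ho, of x "b k"] Elem_fixes_basis[OF h(1)] that supp by auto
  qed
  define c where "c = B (h x) (b j)"
  have "h x = b j + scl c (b (- j))"
  proof (rule eqI)
    fix k assume k: "k \<in> idx"
    have "k = j \<or> k = - j \<or> \<bar>k\<bar> \<noteq> \<bar>j\<bar>" by auto
    then show "B (h x) (b k) = B (b j + scl c (b (- j))) (b k)"
      using j k B1 B0[of k] zero_notin_idx by (auto simp: bilinear B_basis' c_def)
  qed
  moreover have "c = 0"
  proof -
    have "N (b j + scl c (b (- j))) = c"
      using j by (simp add: N_add N_scale N_basis bilinear B_basis')
    then show ?thesis using calculation orth_N[OF ho, of x] N by simp
  qed
  ultimately show ?thesis using h by (intro bexI[of _ h]) auto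
qed

text \<open>
A pivot can be produced from any nonzero coordinate outside the plane of \<open>j\<close>. If there is none, a
root element first copies a coordinate from that plane into the plane of \<open>i\<close>.
\<close>
lemma Elem_make_coordinate_one:
  assumes j: "j \<in> idx" "\<bar>j\<bar> \<in> A" and i: "i \<in> idx" "\<bar>i\<bar> \<in> A" "\<bar>i\<bar> \<noteq> \<bar>j\<bar>"
    and x: "x \<noteq> 0" and supp: "\<And>k. k \<in> idx \<Longrightarrow> \<bar>k\<bar> \<notin> A \<Longrightarrow> B x (b k) = 0"
  shows "\<exists>h\<in>Elem A. B (h x) (b (- j)) = 1"
proof -
  interpret E: permutation_subgroup "Elem A" by (rule Elem_subgroup)
  have off: "\<exists>h\<in>Elem A. B (h y) (b (- j)) = 1"
    if k: "k \<in> idx" "\<bar>k\<bar> \<in> A" "\<bar>k\<bar> \<noteq> \<bar>j\<bar>" "B y (b k) \<noteq> 0" for k y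
  proof -
    let ?t = "(1 - B y (b (- j))) / B y (b k)"
    have "root_elt ?t j k \<in> Elem A" using j k by (intro root_Elem) auto
    moreover have "B (root_elt ?t j k y) (b (- j)) = 1"
      using j k by (auto simp: B_root B_basis')
    ultimately show ?thesis by auto
  qed
  show ?thesis
  proof (cases "\<exists>k\<in>idx. \<bar>k\<bar> \<in> A \<and> \<bar>k\<bar> \<noteq> \<bar>j\<bar> \<and> B x (b k) \<noteq> 0")
    case True
    then show ?thesis using off by auto
  next
    case False
    then obtain m where m: "m \<in> idx" "\<bar>m\<bar> = \<bar>j\<bar>" "B x (b m) \<noteq> 0"
      using eq_zeroI[of x] x supp by metis
    have r: "root_elt 1 i m \<in> Elem A" using i j m by (intro root_Elem) auto
    have "B x (b (- i)) = 0" using False i by (metis abs_minus_cancel minus_idx)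
    then have "B (root_elt 1 i m x) (b (- i)) \<noteq> 0"
      using i m by (auto simp: B_root B_basis')
    then obtain h where "h \<in> Elem A" "B (h (root_elt 1 i m x)) (b (- j)) = 1"
      using off[of "- i"] i by auto
    then show ?thesis using E.comp_mem[OF _ r] by (intro bexI[of _ "h \<circ> root_elt 1 i m"]) auto
  qed
qed

lemma Elem_transitive_hyperbolic_pairs:
  assumes j: "j \<in> idx" "\<bar>j\<bar> \<in> A" and i: "i \<in> idx" "\<bar>i\<bar> \<in> A" "\<bar>i\<bar> \<noteq> \<bar>j\<bar>"
    and N: "N x = 0" "N y = 0" and B: "B x y = 1"
    and supp: "\<And>k. k \<in> idx \<Longrightarrow> \<bar>k\<bar> \<notin> A \<Longrightarrow> B x (b k) = 0"
      "\<And>k. k \<in> idx \<Longrightarrow> \<bar>k\<bar> \<notin> A \<Longrightarrow> B y (b k) = 0"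
  shows "\<exists>h\<in>Elem A. h x = b j \<and> h y = b (- j)"
proof -
  interpret E: permutation_subgroup "Elem A" by (rule Elem_subgroup)
  have supp_Elem: "B (h z) (b k) = 0"
    if "h \<in> Elem A" "\<And>k. k \<in> idx \<Longrightarrow> \<bar>k\<bar> \<notin> A \<Longrightarrow> B z (b k) = 0" "k \<in> idx" "\<bar>k\<bar> \<notin> A"
    for h z k
    using that orth_B[of h z "b k"] Elem_subset_orth[of A] Elem_fixes_basis[of h A k] by auto
  have "x \<noteq> 0" using B B_scale_left[of 0 x y] by auto
  then obtain h1 where h1: "h1 \<in> Elem A" "B (h1 x) (b (- j)) = 1"
    using Elem_make_coordinate_one[OF j i _ supp(1)] by auto
  have "N (h1 x) = 0" using h1(1) Elem_subset_orth[of A] orth_N N by auto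
  then obtain h2 where h2: "h2 \<in> Elem A" "h2 (h1 x) = b j"
    using Elem_clear_coordinates[OF j _ h1(2) supp_Elem[OF h1(1) supp(1)]] by auto
  let ?h = "h2 \<circ> h1"
  have h: "?h \<in> Elem A" by (rule E.comp_mem[OF h2(1) h1(1)])
  then have ho: "?h \<in> orth" using Elem_subset_orth by auto
  have "N (?h y) = 0" using orth_N[OF ho, of y] N by simp
  moreover have "B (?h y) (b (- (- j))) = 1"
    using orth_B[OF ho, of y x] h2(2) B by (simp add: B_commute)
  ultimately obtain h3 where h3: "h3 \<in> Elem A" "h3 (?h y) = b (- j)" "h3 (b j) = b j"
    using Elem_clear_coordinates[of "- j" A "?h y"] j supp_Elem[OF h supp(2)] by auto
  show ?thesis
    using E.comp_mem[OF h3(1) h] h2(2) h3 by (intro bexI[of _ "h3 \<circ> ?h"]) auto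
qed

text \<open>
The isometries supported on the single plane \<open>i\<close>: what elimination in the other planes leaves over.
\<close>
definition plane_orth :: "int \<Rightarrow> ('v \<Rightarrow> 'v) set" where
  "plane_orth i = fixing (b ` {k \<in> idx. \<bar>k\<bar> \<noteq> i})"

text \<open>
Elimination plane by plane. The plane \<open>i\<close> is never processed, so at every step two planes are still
free, which the transitivity on hyperbolic pairs requires. That \<open>i\<close> can be chosen freely is
essential for the computation of commutators.
\<close>
lemma orth_decomposition:
  assumes f: "f \<in> orth" and i: "i \<in> {1..n}"
  shows "\<exists>g\<in>Elem {1..n}. g \<circ> f \<in> plane_orth i"
proof -
  interpret E: permutation_subgroup "Elem {1..n}" by (rule Elem_subgroup)
  have "\<exists>g\<in>Elem {1..n}. \<forall>k\<in>idx. \<bar>k\<bar> \<in> J \<longrightarrow> g (f (b k)) = b k"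
    if "finite J" "J \<subseteq> {1..n} - {i}" for J
    using that
  proof (induction J)
    case empty
    show ?case by (intro bexI[of _ id]) (auto simp: E.id_mem)
  next
    case (insert j J)
    then obtain g where g: "g \<in> Elem {1..n}" "\<And>k. k \<in> idx \<Longrightarrow> \<bar>k\<bar> \<in> J \<Longrightarrow> g (f (b k)) = b k"
      by auto
    have j: "j \<in> idx" "\<bar>j\<bar> = j" "j \<notin> J" "j \<noteq> i" using insert by (auto simp: idx_def)
    have i': "i \<in> idx" "\<bar>i\<bar> = i" "i \<notin> J" using i insert.prems by (auto simp: idx_def)
    let ?A = "{1..n} - J"
    have gf: "g \<circ> f \<in> orth" using g(1) f Elem_subset_orth orth.comp_mem by blast
    have supp: "B ((g \<circ> f) (b m)) (b k) = 0" if "k \<in> idx" "\<bar>k\<bar> \<notin> ?A" "\<bar>m\<bar> = j" "m \<in> idx" for k m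
    proof -
      have "\<bar>k\<bar> \<in> J" using that by (auto simp: idx_def)
      then have "B ((g \<circ> f) (b m)) (b k) = B (b m) (b k)"
        using orth_B[OF gf, of "b m" "b k"] g(2) that by auto
      then show ?thesis using that \<open>\<bar>k\<bar> \<in> J\<close> j by (auto simp: B_basis')
    qed
    have "\<exists>h\<in>Elem ?A. h ((g \<circ> f) (b j)) = b j \<and> h ((g \<circ> f) (b (- j))) = b (- j)"
    proof (rule Elem_transitive_hyperbolic_pairs[OF j(1) _ i'(1)])
      show "B ((g \<circ> f) (b j)) ((g \<circ> f) (b (- j))) = 1"
        using orth_B[OF gf, of "b j" "b (- j)"] j by (simp add: B_basis')
    qed (use j i i' insert.prems supp orth_N[OF gf] N_basis in auto)
    then obtain h where h: "h \<in> Elem ?A" "h (g (f (b j))) = b j" "h (g (f (b (- j)))) = b (- j)"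
      by auto
    have "h \<circ> g \<in> Elem {1..n}" using h(1) g(1) Elem_mono[of ?A "{1..n}"] E.comp_mem by auto
    moreover have "(h \<circ> g) (f (b k)) = b k" if "k \<in> idx" "\<bar>k\<bar> \<in> insert j J" for k
    proof (cases "\<bar>k\<bar> \<in> J")
      case True
      then show ?thesis using g(2) that Elem_fixes_basis[OF h(1), of k] by auto
    next
      case False
      then have "k = j \<or> k = - j" using that j by auto
      then show ?thesis using h by auto
    qed
    ultimately show ?case by (intro bexI[of _ "h \<circ> g"]) auto
  qed
  from this[of "{1..n} - {i}"] obtain g where g: "g \<in> Elem {1..n}"
    "\<And>k. k \<in> idx \<Longrightarrow> \<bar>k\<bar> \<in> {1..n} - {i} \<Longrightarrow> g (f (b k)) = b k" by auto
  have "g \<circ> f \<in> orth" using g(1) f Elem_subset_orth orth.comp_mem by blast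
  moreover have "\<bar>k\<bar> \<in> {1..n} - {i}" if "k \<in> idx" "\<bar>k\<bar> \<noteq> i" for k
    using that by (auto simp: idx_def)
  ultimately show ?thesis
    using g by (intro bexI[of _ g]) (auto simp: plane_orth_def fixing_def)
qed

lemma plane_orth_orth: "f \<in> plane_orth i \<Longrightarrow> f \<in> orth"
  and plane_orth_fixes: "f \<in> plane_orth i \<Longrightarrow> k \<in> idx \<Longrightarrow> \<bar>k\<bar> \<noteq> i \<Longrightarrow> f (b k) = b k"
  by (auto simp: plane_orth_def fixing_def)

text \<open>
A hyperbolic plane contains only two singular lines, so an isometry of the plane permutes them.
\<close>
lemma plane_orth_monomial:
  assumes f: "f \<in> plane_orth i" and k: "k \<in> idx"
  shows "\<exists>c l. l \<in> idx \<and> \<bar>l\<bar> = \<bar>k\<bar> \<and> f (b k) = scl c (b l)"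
proof (cases "\<bar>k\<bar> = i")
  case False
  then show ?thesis using plane_orth_fixes[OF f k] k by (intro exI[of _ 1] exI[of _ k]) auto
next
  case True
  have fo: "f \<in> orth" by (rule plane_orth_orth[OF f])
  define c d where "c = B (f (b k)) (b (- k))" and "d = B (f (b k)) (b k)"
  have B0: "B (f (b k)) (b m) = 0" if "m \<in> idx" "\<bar>m\<bar> \<noteq> \<bar>k\<bar>" for m
    using orth_B[OF fo, of "b k" "b m"] plane_orth_fixes[OF f, of m] that k True
    by (auto simp: B_basis')
  have eq: "f (b k) = scl c (b k) + scl d (b (- k))"
  proof (rule eqI)
    fix m assume m: "m \<in> idx"
    have "m = k \<or> m = - k \<or> \<bar>m\<bar> \<noteq> \<bar>k\<bar>" by auto
    then show "B (f (b k)) (b m) = B (scl c (b k) + scl d (b (- k))) (b m)"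
      using k m B0[of m] zero_notin_idx by (auto simp: bilinear B_basis' c_def d_def)
  qed
  have "N (f (b k)) = c * d" using k by (simp add: eq N_add N_scale N_basis bilinear B_basis')
  then have "c = 0 \<or> d = 0" using orth_N[OF fo, of "b k"] by (simp add: N_basis)
  then show ?thesis
  proof
    assume "c = 0"
    then show ?thesis using eq k by (intro exI[of _ d] exI[of _ "- k"]) auto
  next
    assume "d = 0"
    then show ?thesis using eq k by (intro exI[of _ c] exI[of _ k]) auto
  qed
qed

lemma plane_orth_commute:
  assumes f: "f \<in> plane_orth i" and g: "g \<in> plane_orth j" and "i \<noteq> j"
  shows "f \<circ> g = g \<circ> f"
proof (rule linear_ext)
  have fo: "f \<in> orth" "g \<in> orth" using f g plane_orth_orth by auto
  show "Vector_Spaces.linear scl scl (f \<circ> g)" "Vector_Spaces.linear scl scl (g \<circ> f)"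
    using fo orth_linear orth.comp_mem by auto
  fix k assume k: "k \<in> idx"
  obtain c l where l: "l \<in> idx" "\<bar>l\<bar> = \<bar>k\<bar>" "f (b k) = scl c (b l)"
    using plane_orth_monomial[OF f k] by auto
  obtain d m where m: "m \<in> idx" "\<bar>m\<bar> = \<bar>k\<bar>" "g (b k) = scl d (b m)"
    using plane_orth_monomial[OF g k] by auto
  show "(f \<circ> g) (b k) = (g \<circ> f) (b k)"
  proof (cases "\<bar>k\<bar> = i")
    case True
    then have "g (b k) = b k" "g (b l) = b l"
      using plane_orth_fixes[OF g] k l \<open>i \<noteq> j\<close> by auto
    then show ?thesis using l by (simp add: orth_scale[OF fo(2)])
  next
    case False
    then have "f (b k) = b k" "f (b m) = b m"
      using plane_orth_fixes[OF f] k m by auto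
    then show ?thesis using m by (simp add: orth_scale[OF fo(1)])
  qed
qed

section \<open>The commutator subgroup\<close>
lemma orthogonal_group_eq: "orthogonal_group scl N = BijGroup UNIV \<lparr>carrier := orth\<rparr>"
  by (simp add: orthogonal_group_def orth_def)

lemma carrier_Omega_eq: "carrier (Omega scl N) = derived (BijGroup UNIV) orth"
  by (simp add: Omega_def orthogonal_group_eq
      group.derived_consistent[OF group_BijGroup _ orth.subgroup_H])

text \<open>
Conjugation by a linear isometry transforms a root element by moving its two defining vectors. Here
these move to multiples of basis vectors of the same planes, so the result is a root element again.
\<close>
lemma plane_orth_normalizes_Elem:
  assumes f: "f \<in> plane_orth i" and g: "g \<in> Elem A"
  shows "f \<circ> g \<circ> Hilbert_Choice.inv f \<in> Elem A"
proof (rule generate_conjugate_closed[OF Elem_subgroup _ _ _ g[unfolded Elem_def]])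
  have fo: "f \<in> orth" by (rule plane_orth_orth[OF f])
  show fb: "bij f" by (rule orth_bij[OF fo])
  fix h assume h: "h \<in> roots A"
  then show "bij h" using roots_subset_orth orth_bij by auto
  from h obtain t k l where *: "h = root_elt t k l" "k \<in> idx" "l \<in> idx" "\<bar>k\<bar> \<noteq> \<bar>l\<bar>"
    "\<bar>k\<bar> \<in> A" "\<bar>l\<bar> \<in> A" by (auto simp: roots_def)
  obtain c k' where k': "k' \<in> idx" "\<bar>k'\<bar> = \<bar>k\<bar>" "f (b k) = scl c (b k')"
    using plane_orth_monomial[OF f *(2)] by auto
  obtain d l' where l': "l' \<in> idx" "\<bar>l'\<bar> = \<bar>l\<bar>" "f (b l) = scl d (b l')"
    using plane_orth_monomial[OF f *(3)] by auto
  have "f (root_elt t k l x) = root_elt (t * c * d) k' l' (f x)" for x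
  proof -
    have "B x (b k) = c * B (f x) (b k')" "B x (b l) = d * B (f x) (b l')"
      using orth_B[OF fo, of x "b k"] orth_B[OF fo, of x "b l"] by (simp_all add: k' l' bilinear)
    then show ?thesis
      by (simp add: root_elt_def orth_add[OF fo] orth_diff[OF fo] orth_scale[OF fo] k' l' mult_ac)
  qed
  then have "f \<circ> h \<circ> Hilbert_Choice.inv f = root_elt (t * c * d) k' l'"
    using fb by (simp add: fun_eq_iff *(1) bij_is_surj surj_f_inv_f)
  then show "f \<circ> h \<circ> Hilbert_Choice.inv f \<in> Elem A"
    using * k' l' by (auto intro: root_Elem)
qed

text \<open>
Let \<open>s\<close> and \<open>r\<close> be the reductions of \<open>f\<close> and \<open>g\<close> to the planes 1 and 2. As these two commute and
normalize \<open>Elem {1..n}\<close>, the commutator of \<open>f\<close> and \<open>g\<close> is congruent to that of \<open>s\<close> and \<open>r\<close>, which is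
trivial.
\<close>
lemma orth_commutator_in_Elem:
  assumes n: "2 \<le> n" and f: "f \<in> orth" and g: "g \<in> orth"
  shows "f \<circ> g \<circ> Hilbert_Choice.inv f \<circ> Hilbert_Choice.inv g \<in> Elem {1..n}"
proof -
  interpret E: permutation_subgroup "Elem {1..n}" by (rule Elem_subgroup)
  let ?inv = Hilbert_Choice.inv
  obtain p where p: "p \<in> Elem {1..n}" "p \<circ> f \<in> plane_orth 1"
    using orth_decomposition[OF f, of 1] n by auto
  obtain q where q: "q \<in> Elem {1..n}" "q \<circ> g \<in> plane_orth 2"
    using orth_decomposition[OF g, of 2] n by auto
  define s where "s = p \<circ> f"
  define r where "r = q \<circ> g"
  note bijs = orth_bij[OF f] orth_bij[OF g] E.bij[OF p(1)] E.bij[OF q(1)]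
  have bs: "bij s" "bij r" using bijs by (auto simp: s_def r_def intro: bij_comp)
  have canc: "?inv h (h x) = x" "h (?inv h x) = x" if "bij h" for h :: "'v \<Rightarrow> 'v" and x
    using that by (simp_all add: bij_is_inj bij_is_surj surj_f_inv_f)
  have fs: "f = ?inv p \<circ> s" and gr: "g = ?inv q \<circ> r"
    using bijs by (auto simp: s_def r_def fun_eq_iff canc)
  have inv_f: "?inv f = ?inv s \<circ> p" and inv_g: "?inv g = ?inv r \<circ> q"
    using bijs by (auto simp: s_def r_def fun_eq_iff o_inv_distrib canc)
  have sr: "s (r x) = r (s x)" for x
    using plane_orth_commute[OF p(2) q(2)] by (simp add: s_def r_def fun_eq_iff)
  have sr': "r (?inv s x) = ?inv s (r x)" for x
    using bs sr[of "?inv s x"] by (metis canc)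
  have "f \<circ> g \<circ> ?inv f \<circ> ?inv g
      = ?inv p \<circ> (s \<circ> ?inv q \<circ> ?inv s) \<circ> (r \<circ> p \<circ> ?inv r) \<circ> q"
    unfolding inv_f inv_g by (subst fs, subst gr) (simp add: fun_eq_iff sr')
  moreover have "s \<circ> ?inv q \<circ> ?inv s \<in> Elem {1..n}" "r \<circ> p \<circ> ?inv r \<in> Elem {1..n}"
    using p q by (auto simp: s_def r_def intro!: plane_orth_normalizes_Elem E.inv_mem)
  ultimately show ?thesis using p(1) q(1) E.comp_mem E.inv_mem by auto
qed

text \<open>
For at least three planes this identifies the commutator subgroup over every field, the smallest
fields included.
\<close>
theorem carrier_Omega_eq_Elem:
  assumes n: "3 \<le> n"
  shows "carrier (Omega scl N) = Elem {1..n}"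
proof
  interpret E: permutation_subgroup "Elem {1..n}" by (rule Elem_subgroup)
  note group_simps = mult_BijGroup_UNIV inv_BijGroup_UNIV orth_bij bij_comp bij_imp_bij_inv
  show "carrier (Omega scl N) \<subseteq> Elem {1..n}"
    unfolding carrier_Omega_eq derived_def
    using n orth_commutator_in_Elem
    by (intro E.generate_subset) (auto simp: group_simps)
  interpret D: permutation_subgroup "derived (BijGroup UNIV) orth"
    using group.derived_is_subgroup[OF group_BijGroup, of orth UNIV] orth_bij
    by (auto simp: permutation_subgroup_def carrier_BijGroup_UNIV)
  have "roots {1..n} \<subseteq> derived (BijGroup UNIV) orth"
  proof
    fix g assume "g \<in> roots {1..n}"
    then obtain t k l where g: "g = root_elt t k l" "k \<in> idx" "l \<in> idx" "\<bar>k\<bar> \<noteq> \<bar>l\<bar>"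
      by (auto simp: roots_def)
    \<comment> \<open>The third plane for the commutator relation.\<close>
    have "\<exists>m\<in>{1, 2, 3}. m \<noteq> \<bar>k\<bar> \<and> m \<noteq> \<bar>l\<bar>" by auto
    then obtain m where m: "m \<in> {1, 2, 3}" "m \<noteq> \<bar>k\<bar>" "m \<noteq> \<bar>l\<bar>" by blast
    then have m': "m \<in> idx" "\<bar>m\<bar> = m" using n by (auto simp: idx_def)
    have o: "root_elt t k m \<in> orth" "root_elt 1 (- m) l \<in> orth"
      using g m m' by (auto intro!: root_orth)
    have "g = root_elt t k m \<circ> root_elt 1 (- m) l \<circ> Hilbert_Choice.inv (root_elt t k m)
        \<circ> Hilbert_Choice.inv (root_elt 1 (- m) l)"
      using root_commutator[OF g(2,3) m'(1) g(4), of t 1] g m m' by (simp add: inv_root)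
    then have "g = root_elt t k m \<otimes>\<^bsub>BijGroup UNIV\<^esub> root_elt 1 (- m) l
        \<otimes>\<^bsub>BijGroup UNIV\<^esub> inv\<^bsub>BijGroup UNIV\<^esub> (root_elt t k m)
        \<otimes>\<^bsub>BijGroup UNIV\<^esub> inv\<^bsub>BijGroup UNIV\<^esub> (root_elt 1 (- m) l)"
      using o by (simp add: group_simps)
    then show "g \<in> derived (BijGroup UNIV) orth"
      unfolding derived_def using o by (intro generate.incl) blast
  qed
  then show "Elem {1..n} \<subseteq> carrier (Omega scl N)"
    unfolding carrier_Omega_eq Elem_def by (rule D.generate_subset)
qed

section \<open>Separating the factors of products of two root elements\<close>
lemma root_basis:
  assumes "k \<in> idx" "l \<in> idx" "m \<in> idx"
  shows "root_elt t k l (b m) =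
    b m + (if m = - l then scl t (b k) else 0) - (if m = - k then scl t (b l) else 0)"
  using assms by (auto simp: root_elt_def B_basis')

lemma linear_comp:
  "Vector_Spaces.linear scl scl f \<Longrightarrow> Vector_Spaces.linear scl scl g \<Longrightarrow>
    Vector_Spaces.linear scl scl (f \<circ> g)"
  by (rule Vector_Spaces.linear_compose)

lemma root_linear_simps:
  "root_elt t k l (x + y) = root_elt t k l x + root_elt t k l y"
  "root_elt t k l (x - y) = root_elt t k l x - root_elt t k l y"
  "root_elt t k l 0 = 0"
  "root_elt t k l (- x) = - root_elt t k l x"
  "root_elt t k l (scl c x) = scl c (root_elt t k l x)"
  using B_scale_left[of 0] by (simp_all add: root_elt_def bilinear algebra_simps)

text \<open>
Simplification rules for comparing signed indices of different planes. Supplied in this form they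
decide all conditions in the computations below without arithmetic.
\<close>
lemma abs_neqD:
  fixes k l :: int
  assumes "\<bar>k\<bar> \<noteq> \<bar>l\<bar>"
  shows "k \<noteq> l \<and> k \<noteq> - l \<and> - k \<noteq> l \<and> l \<noteq> k \<and> l \<noteq> - k \<and> - l \<noteq> k"
  using assms by auto

lemma idx_neqD:
  assumes "k \<in> idx"
  shows "k \<noteq> 0 \<and> k \<noteq> - k \<and> - k \<noteq> k"
  using assms zero_notin_idx by auto

text \<open>
Among the four ways to pair a factor of the first product with a factor of the second, only the
roots \<open>(- j, - k)\<close> and \<open>(k, i)\<close> have a root as their sum, the other pairs commute. So the commutator of
the two products is a single root element.
\<close>
lemma root_commutator_pair:
  assumes "i \<in> idx" "j \<in> idx" "k \<in> idx" "z \<in> idx"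
    and "\<bar>i\<bar> \<noteq> \<bar>j\<bar>" "\<bar>i\<bar> \<noteq> \<bar>k\<bar>" "\<bar>j\<bar> \<noteq> \<bar>k\<bar>" "\<bar>i\<bar> \<noteq> \<bar>z\<bar>" "\<bar>j\<bar> \<noteq> \<bar>z\<bar>" "\<bar>k\<bar> \<noteq> \<bar>z\<bar>"
  shows "(root_elt t i z \<circ> root_elt t' (- j) (- k)) \<circ> (root_elt s (- j) z \<circ> root_elt s' k i)
    = root_elt (- (t' * s')) i (- j) \<circ>
      ((root_elt s (- j) z \<circ> root_elt s' k i) \<circ> (root_elt t i z \<circ> root_elt t' (- j) (- k)))"
proof (rule linear_ext)
  fix m assume m: "m \<in> idx"
  show "((root_elt t i z \<circ> root_elt t' (- j) (- k)) \<circ> (root_elt s (- j) z \<circ> root_elt s' k i)) (b m)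
    = (root_elt (- (t' * s')) i (- j) \<circ>
      ((root_elt s (- j) z \<circ> root_elt s' k i) \<circ> (root_elt t i z \<circ> root_elt t' (- j) (- k)))) (b m)"
  proof -
    consider "m = i" | "m = j" | "m = k" | "m = z" | "m = - i" | "m = - j" | "m = - k" | "m = - z"
      | "m \<noteq> i" "m \<noteq> j" "m \<noteq> k" "m \<noteq> z" "m \<noteq> - i" "m \<noteq> - j" "m \<noteq> - k" "m \<noteq> - z"
      by blast
    then show ?thesis
      using m by cases (simp_all add: root_linear_simps root_basis assms(1-4)
        assms(5-10)[THEN abs_neqD] assms(1-4)[THEN idx_neqD]
        algebra_simps)
  qed
qed (intro linear_comp linear_root)+

text \<open>
The three roots \<open>(- k, - z)\<close>, \<open>(- k, z)\<close> and \<open>(i, j)\<close> are pairwise orthogonal. The given products provide, for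
this triple, the coefficient vectors \<open>(t, 0, t)\<close> and \<open>(0, t, - t)\<close>, which satisfy one linear relation.
The commutator of the products for \<open>i\<close> and \<open>j\<close> has in this triple the coefficients \<open>(- t, t, - t)\<close>, which
violate the relation; the discrepancy is the single root element of \<open>(i, j)\<close>. The first two factors on
the right are the remaining part of the commutator, and are covered by \<open>root_commutator_pair\<close>.
\<close>
lemma root_isolation:
  assumes "i \<in> idx" "j \<in> idx" "k \<in> idx" "z \<in> idx"
    and "\<bar>i\<bar> \<noteq> \<bar>j\<bar>" "\<bar>i\<bar> \<noteq> \<bar>k\<bar>" "\<bar>j\<bar> \<noteq> \<bar>k\<bar>" "\<bar>i\<bar> \<noteq> \<bar>z\<bar>" "\<bar>j\<bar> \<noteq> \<bar>z\<bar>" "\<bar>k\<bar> \<noteq> \<bar>z\<bar>"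
  shows "(root_elt t i z \<circ> root_elt t (- j) (- k)) \<circ> (root_elt 1 j (- z) \<circ> root_elt (- 1) (- k) (- i))
    = root_elt (- (t * t)) (- k) i \<circ> (root_elt (- t) j (- k) \<circ>
      ((root_elt (- t) (- k) (- z) \<circ> root_elt (- t) i j) \<circ>
      ((root_elt t (- k) z \<circ> root_elt (- t) i j) \<circ> (root_elt t i j \<circ>
      ((root_elt 1 j (- z) \<circ> root_elt (- 1) (- k) (- i)) \<circ>
       (root_elt t i z \<circ> root_elt t (- j) (- k)))))))"
proof (rule linear_ext)
  fix m assume m: "m \<in> idx"
  show "((root_elt t i z \<circ> root_elt t (- j) (- k)) \<circ> (root_elt 1 j (- z) \<circ> root_elt (- 1) (- k) (- i))) (b m)
    = (root_elt (- (t * t)) (- k) i \<circ> (root_elt (- t) j (- k) \<circ>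
      ((root_elt (- t) (- k) (- z) \<circ> root_elt (- t) i j) \<circ>
      ((root_elt t (- k) z \<circ> root_elt (- t) i j) \<circ> (root_elt t i j \<circ>
      ((root_elt 1 j (- z) \<circ> root_elt (- 1) (- k) (- i)) \<circ>
       (root_elt t i z \<circ> root_elt t (- j) (- k)))))))) (b m)"
  proof -
    consider "m = i" | "m = j" | "m = k" | "m = z" | "m = - i" | "m = - j" | "m = - k" | "m = - z"
      | "m \<noteq> i" "m \<noteq> j" "m \<noteq> k" "m \<noteq> z" "m \<noteq> - i" "m \<noteq> - j" "m \<noteq> - k" "m \<noteq> - z"
      by blast
    then show ?thesis
      using m by cases (simp_all add: root_linear_simps root_basis assms(1-4)
        assms(5-10)[THEN abs_neqD] assms(1-4)[THEN idx_neqD]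
        algebra_simps)
  qed
qed (intro linear_comp linear_root)+

text \<open>
For octonions, \<open>(i, j, k)\<close> is \<open>(1, 2, 3)\<close> up to cyclic permutation and sign, \<open>z\<close> is \<open>4\<close> or \<open>- 4\<close>, and
the hypotheses are supplied by left and right translations.
\<close>
lemma root_in_subgroup:
  assumes H: "permutation_subgroup H"
    and idx: "i \<in> idx" "j \<in> idx" "k \<in> idx" "z \<in> idx"
      "\<bar>i\<bar> \<noteq> \<bar>j\<bar>" "\<bar>i\<bar> \<noteq> \<bar>k\<bar>" "\<bar>j\<bar> \<noteq> \<bar>k\<bar>" "\<bar>i\<bar> \<noteq> \<bar>z\<bar>" "\<bar>j\<bar> \<noteq> \<bar>z\<bar>" "\<bar>k\<bar> \<noteq> \<bar>z\<bar>"
    and Li: "\<And>t. root_elt t i z \<circ> root_elt t (- j) (- k) \<in> H"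
    and Lj: "\<And>t. root_elt t j z \<circ> root_elt t (- k) (- i) \<in> H"
    and Rj: "\<And>t. root_elt t j (- z) \<circ> root_elt (- t) (- k) (- i) \<in> H"
    and L'k: "\<And>t. root_elt t (- k) (- z) \<circ> root_elt t i j \<in> H"
    and R'k: "\<And>t. root_elt t (- k) z \<circ> root_elt (- t) i j \<in> H"
  shows "root_elt t i j \<in> H" "root_elt t j (- k) \<in> H" "root_elt t i (- k) \<in> H"
proof -
  interpret H: permutation_subgroup H by (rule H)
  show jk: "root_elt t j (- k) \<in> H" for t
  proof -
    have "root_elt t j (- k) \<circ> ((root_elt 1 (- k) z \<circ> root_elt (- 1) i j)
        \<circ> (root_elt t j z \<circ> root_elt t (- k) (- i))) \<in> H"
      using root_commutator_pair[of j k i z t t 1 "- 1"] idx H.comp_mem[OF Lj[of t] R'k[of 1]]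
      by simp
    then show ?thesis by (rule H.cancel_right[OF H.comp_mem[OF R'k Lj]])
  qed
  show ik: "root_elt t i (- k) \<in> H" for t
  proof -
    have Li': "root_elt t i z \<circ> root_elt (- t) (- k) (- j) \<in> H"
      using Li[of t] root_swap[of t "- j" "- k"] by simp
    have R'k': "root_elt 1 (- k) z \<circ> root_elt 1 j i \<in> H"
      using R'k[of 1] root_swap[of 1 j i] by simp
    have "root_elt t i (- k) \<circ> ((root_elt 1 (- k) z \<circ> root_elt 1 j i)
        \<circ> (root_elt t i z \<circ> root_elt (- t) (- k) (- j))) \<in> H"
      using root_commutator_pair[of i k j z t "- t" 1 1] idx H.comp_mem[OF Li' R'k']
      by simp
    then show ?thesis by (rule H.cancel_right[OF H.comp_mem[OF R'k' Li']])
  qed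
  have ki: "root_elt (- (t * t)) (- k) i \<in> H"
    using ik[of "t * t"] root_swap[of "t * t" i "- k"] by simp
  have "(root_elt t i z \<circ> root_elt t (- j) (- k))
      \<circ> (root_elt 1 j (- z) \<circ> root_elt (- 1) (- k) (- i)) \<in> H"
    by (rule H.comp_mem[OF Li Rj])
  then have "root_elt t i j \<circ> ((root_elt 1 j (- z) \<circ> root_elt (- 1) (- k) (- i))
      \<circ> (root_elt t i z \<circ> root_elt t (- j) (- k))) \<in> H"
    unfolding root_isolation[OF idx]
    using H.cancel_left ki jk[of "- t"] L'k[of "- t"] R'k[of t] by metis
  then show "root_elt t i j \<in> H"
    by (rule H.cancel_right[OF H.comp_mem[OF Rj Li]])
qed

end

section \<open>The split octonions as a hyperbolic space\<close>
fun oct_polar :: "'a::field octonion \<Rightarrow> 'a octonion \<Rightarrow> 'a" where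
  "oct_polar (Zorn a \<alpha> \<beta> b) (Zorn c \<gamma> \<delta> d) =
     a * d + b * c - scalar_product \<alpha> \<delta> - scalar_product \<beta> \<gamma>"

text \<open>
The planes 1, 2, 3 are the pairs of corresponding coordinates of the two off-diagonal vectors, and
plane 4 is the diagonal. The minus signs compensate the sign of the dot product in the norm.
\<close>
definition oct_basis :: "int \<Rightarrow> 'a::field octonion" where
  "oct_basis k = Zorn (of_bool (k = 4))
     (vector [of_bool (k = 1), of_bool (k = 2), of_bool (k = 3)])
     (vector [- of_bool (k = - 1), - of_bool (k = - 2), - of_bool (k = - 3)])
     (of_bool (k = - 4))"

lemmas coordinate_simps = scalar_product_def cross_prod_def sum_3 vec_eq_iff forall_3

lemma weights_4: "{k::int. 1 \<le> \<bar>k\<bar> \<and> \<bar>k\<bar> \<le> 4} = {1, 2, 3, 4, - 1, - 2, - 3, - 4}"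
  by auto

interpretation oct: hyperbolic_space oct_scale oct_norm oct_polar 4 oct_basis
proof
  fix x y z :: "'a octonion" and c :: 'a and k l :: int
  show "oct_norm (x + y) = oct_norm x + oct_norm y + oct_polar x y"
    by (cases x; cases y) (simp add: coordinate_simps algebra_simps)
  show "oct_norm (oct_scale c x) = c * c * oct_norm x"
    by (cases x) (simp add: coordinate_simps algebra_simps)
  show "oct_polar (x + y) z = oct_polar x z + oct_polar y z"
    by (cases x; cases y; cases z) (simp add: coordinate_simps algebra_simps)
  show "oct_polar (oct_scale c x) z = c * oct_polar x z"
    by (cases x; cases z) (simp add: coordinate_simps algebra_simps)
  show "oct_norm (oct_basis k :: 'a octonion) = 0"
    by (auto simp: oct_basis_def coordinate_simps)
  show "x = (\<Sum>k\<in>{k. 1 \<le> \<bar>k\<bar> \<and> \<bar>k\<bar> \<le> 4}. oct_scale (oct_polar x (oct_basis (- k))) (oct_basis k))"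
    unfolding weights_4 by (cases x) (simp add: oct_basis_def coordinate_simps)
  assume "1 \<le> \<bar>k\<bar>" "\<bar>k\<bar> \<le> 4" "1 \<le> \<bar>l\<bar>" "\<bar>l\<bar> \<le> 4"
  then have "k \<in> {1, 2, 3, 4, - 1, - 2, - 3, - 4}" "l \<in> {1, 2, 3, 4, - 1, - 2, - 3, - 4}" by auto
  then show "oct_polar (oct_basis k) (oct_basis l :: 'a octonion) = (if l = - k then 1 else 0)"
    by (auto simp: oct_basis_def coordinate_simps)
qed

section \<open>Translations by the unipotent generators\<close>
definition upper :: "'a::field ^ 3 \<Rightarrow> 'a octonion" where
  "upper v = Zorn 1 v 0 1"

definition lower :: "'a::field ^ 3 \<Rightarrow> 'a octonion" where
  "lower v = Zorn 1 0 v 1"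

text \<open>
Translation by an upper or lower unipotent element acts on the diagonal plane and an off-diagonal
plane through the dot product and scaling, and on two off-diagonal planes through the cross product.
This accounts for the two kinds of root elements. Left and right translation differ in the
exchange of the diagonal entries and in the sign of the cross product.
\<close>
lemma left_upper:
  "(\<lambda>x. upper v * x) =
    oct.root_elt (v $ 1) 1 4 \<circ> oct.root_elt (v $ 2) 2 4 \<circ> oct.root_elt (v $ 3) 3 4 \<circ>
    oct.root_elt (v $ 1) (- 2) (- 3) \<circ> oct.root_elt (v $ 2) (- 3) (- 1) \<circ> oct.root_elt (v $ 3) (- 1) (- 2)"
  by (rule ext, rename_tac x, case_tac x)
    (simp add: oct.root_elt_def oct_basis_def upper_def coordinate_simps algebra_simps)

lemma right_upper:
  "(\<lambda>x. x * upper v) =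
    oct.root_elt (v $ 1) 1 (- 4) \<circ> oct.root_elt (v $ 2) 2 (- 4) \<circ> oct.root_elt (v $ 3) 3 (- 4) \<circ>
    oct.root_elt (- v $ 1) (- 2) (- 3) \<circ> oct.root_elt (- v $ 2) (- 3) (- 1) \<circ> oct.root_elt (- v $ 3) (- 1) (- 2)"
  by (rule ext, rename_tac x, case_tac x)
    (simp add: oct.root_elt_def oct_basis_def upper_def coordinate_simps algebra_simps)

lemma left_lower:
  "(\<lambda>x. lower v * x) =
    oct.root_elt (- v $ 1) (- 1) (- 4) \<circ> oct.root_elt (- v $ 2) (- 2) (- 4) \<circ> oct.root_elt (- v $ 3) (- 3) (- 4) \<circ>
    oct.root_elt (- v $ 1) 2 3 \<circ> oct.root_elt (- v $ 2) 3 1 \<circ> oct.root_elt (- v $ 3) 1 2"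
  by (rule ext, rename_tac x, case_tac x)
    (simp add: oct.root_elt_def oct_basis_def lower_def coordinate_simps algebra_simps)

lemma right_lower:
  "(\<lambda>x. x * lower v) =
    oct.root_elt (- v $ 1) (- 1) 4 \<circ> oct.root_elt (- v $ 2) (- 2) 4 \<circ> oct.root_elt (- v $ 3) (- 3) 4 \<circ>
    oct.root_elt (v $ 1) 2 3 \<circ> oct.root_elt (v $ 2) 3 1 \<circ> oct.root_elt (v $ 3) 1 2"
  by (rule ext, rename_tac x, case_tac x)
    (simp add: oct.root_elt_def oct_basis_def lower_def coordinate_simps algebra_simps)

lemma moufang: "(z * x) * (y * z) = (z * (x * y)) * (z :: 'a::field octonion)"
  by (cases x; cases y; cases z) (simp add: coordinate_simps algebra_simps)

lemma upper_cancel: "upper (- v) * (upper v * x) = x"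
  by (cases x) (simp add: upper_def coordinate_simps algebra_simps)

lemma lower_cancel: "lower (- v) * (lower v * x) = x"
  by (cases x) (simp add: lower_def coordinate_simps algebra_simps)

lemma lower_times_upper: "lower \<beta> * upper \<alpha> = Zorn 1 \<alpha> \<beta> (1 + scalar_product \<beta> \<alpha>)"
  by (simp add: upper_def lower_def coordinate_simps algebra_simps)

lemma scalar_product_surj:
  fixes \<beta> :: "'a::field ^ 3"
  assumes "\<beta> \<noteq> 0"
  shows "\<exists>\<gamma>. scalar_product \<gamma> \<beta> = c"
proof -
  from assms consider "\<beta> $ 1 \<noteq> 0" | "\<beta> $ 2 \<noteq> 0" | "\<beta> $ 3 \<noteq> 0"
    by (auto simp: vec_eq_iff forall_3)
  then show ?thesis
  proof cases
    case 1 then show ?thesis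
      by (intro exI[of _ "vector [c / \<beta> $ 1, 0, 0]"]) (simp add: coordinate_simps)
  next
    case 2 then show ?thesis
      by (intro exI[of _ "vector [0, c / \<beta> $ 2, 0]"]) (simp add: coordinate_simps)
  next
    case 3 then show ?thesis
      by (intro exI[of _ "vector [0, 0, c / \<beta> $ 3]"]) (simp add: coordinate_simps)
  qed
qed

text \<open>
If the upper left entry is 1, the element is a product of a lower and an upper element, since the
norm determines the lower right entry. Multiplication by an upper element turns this entry into 1 unless
the vector \<open>\<beta>\<close> below the diagonal is zero; in that case a lower element makes \<open>\<beta>\<close> nonzero first. The inverses
of these steps exist because unipotent factors cancel from the left, which replaces associativity.
\<close>
lemma unit_octonion_induct:
  fixes x :: "'a::field octonion"
  assumes x: "oct_norm x = 1"
    and upper: "\<And>v. P (upper v)" and lower: "\<And>v. P (lower v)"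
    and mult: "\<And>z x. P z \<Longrightarrow> P x \<Longrightarrow> P (z * x)"
  shows "P x"
proof -
  have one: "P (Zorn 1 \<alpha> \<beta> b)" if "oct_norm (Zorn 1 \<alpha> \<beta> b) = 1" for \<alpha> \<beta> and b :: 'a
  proof -
    have "Zorn 1 \<alpha> \<beta> b = lower \<beta> * upper \<alpha>"
      using that by (simp add: lower_times_upper coordinate_simps algebra_simps)
    then show ?thesis using mult upper lower by simp
  qed
  have N_upper: "oct_norm (upper v * y) = oct_norm y" for v and y :: "'a octonion"
    by (simp add: oct_norm_mult) (simp add: upper_def coordinate_simps)
  have N_lower: "oct_norm (lower v * y) = oct_norm y" for v and y :: "'a octonion"
    by (simp add: oct_norm_mult) (simp add: lower_def coordinate_simps)
  have nonzero: "P (Zorn a \<alpha> \<beta> b)"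
    if N: "oct_norm (Zorn a \<alpha> \<beta> b) = 1" and "\<beta> \<noteq> 0" for a \<alpha> \<beta> and b :: 'a
  proof -
    obtain \<gamma> where "scalar_product \<gamma> \<beta> = 1 - a" using scalar_product_surj[OF \<open>\<beta> \<noteq> 0\<close>] by blast
    then obtain \<alpha>' \<beta>' b' where u: "upper \<gamma> * Zorn a \<alpha> \<beta> b = Zorn 1 \<alpha>' \<beta>' b'"
      by (simp add: upper_def)
    then have "P (upper \<gamma> * Zorn a \<alpha> \<beta> b)"
      using one N N_upper[of \<gamma> "Zorn a \<alpha> \<beta> b"] by simp
    then have "P (upper (- \<gamma>) * (upper \<gamma> * Zorn a \<alpha> \<beta> b))" by (rule mult[OF upper])
    then show ?thesis by (simp only: upper_cancel)
  qed
  obtain a \<alpha> \<beta> b where x_eq: "x = Zorn a \<alpha> \<beta> b" by (cases x)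
  show ?thesis
  proof (cases "\<beta> = 0")
    case False
    then show ?thesis using nonzero x by (simp add: x_eq)
  next
    case True
    define v :: "'a ^ 3" where "v = vector [1, 0, 0]"
    have "a \<noteq> 0" using x by (auto simp: x_eq True scalar_product_def)
    have "lower v * x = Zorn a \<alpha> (a *s v) (scalar_product v \<alpha> + b)"
      by (simp add: x_eq True lower_def coordinate_simps algebra_simps)
    moreover have "a *s v \<noteq> 0" using \<open>a \<noteq> 0\<close> by (simp add: v_def coordinate_simps)
    ultimately have "P (lower v * x)"
      using nonzero N_lower[of v x] x by simp
    then have "P (lower (- v) * (lower v * x))" by (rule mult[OF lower])
    then show ?thesis by (simp only: lower_cancel)
  qed
qed


text \<open>
The Moufang identity \<open>(z x) (y z) = (z (x y)) z\<close>, read as an equation between functions of \<open>y\<close> and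
between functions of \<open>x\<close>, expresses left translation by \<open>z x\<close> and right translation by \<open>y z\<close> through the
translations by the factors. So no associativity is needed to pass from generators of the loop to
all of its elements.
\<close>
lemma unit_translations_mem:
  fixes H :: "('a::field octonion \<Rightarrow> 'a octonion) set"
  assumes H: "permutation_subgroup H"
    and upper: "\<And>v. (\<lambda>y. upper v * y) \<in> H" "\<And>v. (\<lambda>y. y * upper v) \<in> H"
    and lower: "\<And>v. (\<lambda>y. lower v * y) \<in> H" "\<And>v. (\<lambda>y. y * lower v) \<in> H"
    and x: "oct_norm x = 1"
  shows "(\<lambda>y. x * y) \<in> H \<and> (\<lambda>y. y * x) \<in> H"
  using x
proof (rule unit_octonion_induct)
  interpret H: permutation_subgroup H by (rule H)
  fix z x
  assume z: "(\<lambda>y. z * y) \<in> H \<and> (\<lambda>y. y * z) \<in> H" and x: "(\<lambda>y. x * y) \<in> H \<and> (\<lambda>y. y * x) \<in> H"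
  have "(\<lambda>y. (z * x) * y) \<circ> (\<lambda>y. y * z) = (\<lambda>y. y * z) \<circ> ((\<lambda>y. z * y) \<circ> (\<lambda>y. x * y))"
    by (simp add: fun_eq_iff moufang)
  then have "(\<lambda>y. (z * x) * y) \<circ> (\<lambda>y. y * z) \<in> H" using z x by (simp only: H.comp_mem)
  then have L: "(\<lambda>y. (z * x) * y) \<in> H" using z by (blast intro: H.cancel_right)
  have "(\<lambda>y. y * (z * x)) \<circ> (\<lambda>y. x * y) = (\<lambda>y. y * x) \<circ> ((\<lambda>y. x * y) \<circ> (\<lambda>y. y * z))"
    by (simp add: fun_eq_iff moufang)
  then have "(\<lambda>y. y * (z * x)) \<circ> (\<lambda>y. x * y) \<in> H" using z x by (simp only: H.comp_mem)
  then have "(\<lambda>y. y * (z * x)) \<in> H" using x by (blast intro: H.cancel_right)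
  with L show "(\<lambda>y. (z * x) * y) \<in> H \<and> (\<lambda>y. y * (z * x)) \<in> H" ..
qed (use upper lower in auto)

section \<open>The group generated by the translations\<close>
definition unit_translations :: "('a::field octonion \<Rightarrow> 'a octonion) set" where
  "unit_translations = (\<lambda>a x. a * x) ` {a. oct_norm a = 1} \<union> (\<lambda>a x. x * a) ` {a. oct_norm a = 1}"

lemma unit_translations_subset_Elem:
  "(unit_translations :: ('a::field octonion \<Rightarrow> 'a octonion) set) \<subseteq> oct.Elem {1..4}"
proof -
  interpret E: permutation_subgroup "oct.Elem {1..4} :: ('a octonion \<Rightarrow> 'a octonion) set"
    by (rule oct.Elem_subgroup)
  have gens: "(\<lambda>y. upper v * y) \<in> oct.Elem {1..4}" "(\<lambda>y. y * upper v) \<in> oct.Elem {1..4}"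
    "(\<lambda>y. lower v * y) \<in> oct.Elem {1..4}" "(\<lambda>y. y * lower v) \<in> oct.Elem {1..4}" for v :: "'a ^ 3"
    unfolding left_upper right_upper left_lower right_lower
    by (intro E.comp_mem oct.root_Elem; simp add: oct.idx_def)+
  then show ?thesis
    using unit_translations_mem[OF oct.Elem_subgroup gens] by (auto simp: unit_translations_def)
qed

lemma Elem_subset_translation_group:
  "oct.Elem {1..4} \<subseteq> generate (BijGroup UNIV) (unit_translations :: ('a::field octonion \<Rightarrow> _) set)"
proof -
  define G :: "('a octonion \<Rightarrow> 'a octonion) set" where "G = generate (BijGroup UNIV) unit_translations"
  have GG: "permutation_subgroup G"
    unfolding G_def using unit_translations_subset_Elem oct.Elem_subset_orth oct.orth_bij
    by (intro permutation_subgroup_generate) blast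
  then interpret G: permutation_subgroup G .
  have "oct_norm (upper v :: 'a octonion) = 1" "oct_norm (lower v :: 'a octonion) = 1" for v
    by (simp_all add: upper_def lower_def scalar_product_def)
  then have mem: "(\<lambda>y. upper v * y) \<in> G" "(\<lambda>y. y * upper v) \<in> G"
    "(\<lambda>y. lower v * y) \<in> G" "(\<lambda>y. y * lower v) \<in> G" for v
    unfolding G_def by (auto simp: unit_translations_def intro!: generate.incl)
  define v where "v i t =
      (vector [if i = 1 then t else 0, if i = 2 then t else 0, if i = 3 then t else 0] :: 'a ^ 3)"
    for i :: int and t
  define cyc where "cyc = {(1::int, 2::int, 3::int), (2, 3, 1), (3, 1, 2)}"
  \<comment> \<open>The cyclic triples record the structure constants of the cross product.\<close>
  have L: "oct.root_elt t i 4 \<circ> oct.root_elt t (- j) (- k) \<in> G"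
    and R: "oct.root_elt t i (- 4) \<circ> oct.root_elt (- t) (- j) (- k) \<in> G"
    and L': "oct.root_elt t (- i) (- 4) \<circ> oct.root_elt t j k \<in> G"
    and R': "oct.root_elt t (- i) 4 \<circ> oct.root_elt (- t) j k \<in> G"
    if "(i, j, k) \<in> cyc" for i j k t
    using that mem(1)[of "v i t"] mem(2)[of "v i t"] mem(3)[of "v i (- t)"] mem(4)[of "v i (- t)"]
    unfolding left_upper right_upper left_lower right_lower cyc_def
    by (auto simp: v_def oct.root_zero comp_def)
  have idx4: "\<And>m. m \<in> oct.idx \<longleftrightarrow> m \<in> {1, 2, 3, 4, - 1, - 2, - 3, - 4}"
    by (auto simp: oct.idx_def)
  have pos: "oct.root_elt t i j \<in> G \<and> oct.root_elt t j (- k) \<in> G \<and> oct.root_elt t i (- k) \<in> G"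
    if c: "(i, j, k) \<in> cyc" for i j k t
  proof -
    have c': "(j, k, i) \<in> cyc" "(k, i, j) \<in> cyc" using c by (auto simp: cyc_def)
    have d: "i \<in> oct.idx" "j \<in> oct.idx" "k \<in> oct.idx" "4 \<in> oct.idx"
      "\<bar>i\<bar> \<noteq> \<bar>j\<bar>" "\<bar>i\<bar> \<noteq> \<bar>k\<bar>" "\<bar>j\<bar> \<noteq> \<bar>k\<bar>" "\<bar>i\<bar> \<noteq> \<bar>4\<bar>" "\<bar>j\<bar> \<noteq> \<bar>4\<bar>" "\<bar>k\<bar> \<noteq> \<bar>4\<bar>"
      using c by (auto simp: cyc_def idx4)
    note iso = oct.root_in_subgroup[OF GG d L[OF c] L[OF c'(1)] R[OF c'(1)] L'[OF c'(2)] R'[OF c'(2)]]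
    show ?thesis using iso by blast
  qed
  \<comment> \<open>Negating all indices exchanges the upper and the lower translations.\<close>
  have neg: "oct.root_elt t (- i) (- j) \<in> G \<and> oct.root_elt t (- j) k \<in> G \<and> oct.root_elt t (- i) k \<in> G"
    if c: "(i, j, k) \<in> cyc" for i j k t
  proof -
    have c': "(j, k, i) \<in> cyc" "(k, i, j) \<in> cyc" using c by (auto simp: cyc_def)
    have d: "- i \<in> oct.idx" "- j \<in> oct.idx" "- k \<in> oct.idx" "- 4 \<in> oct.idx"
      "\<bar>- i\<bar> \<noteq> \<bar>- j\<bar>" "\<bar>- i\<bar> \<noteq> \<bar>- k\<bar>" "\<bar>- j\<bar> \<noteq> \<bar>- k\<bar>"
      "\<bar>- i\<bar> \<noteq> \<bar>- 4\<bar>" "\<bar>- j\<bar> \<noteq> \<bar>- 4\<bar>" "\<bar>- k\<bar> \<noteq> \<bar>- 4\<bar>"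
      using c by (auto simp: cyc_def idx4)
    note iso = oct.root_in_subgroup[OF GG d, unfolded minus_minus,
        OF L'[OF c] L'[OF c'(1)] R'[OF c'(1)] L[OF c'(2)] R[OF c'(2)]]
    show ?thesis using iso by blast
  qed
  \<comment> \<open>With one factor of each coupled pair available, the other one follows.\<close>
  have four: "oct.root_elt t i 4 \<in> G \<and> oct.root_elt t i (- 4) \<in> G \<and>
      oct.root_elt t (- i) (- 4) \<in> G \<and> oct.root_elt t (- i) 4 \<in> G"
    if c: "(i, j, k) \<in> cyc" for i j k t
  proof -
    have "(j, k, i) \<in> cyc" using c by (auto simp: cyc_def)
    then show ?thesis
      using pos[of j k i] neg[of j k i] L[OF c] R[OF c] L'[OF c] R'[OF c] G.cancel_right by blast
  qed
  \<comment> \<open>Each root has been obtained with its two indices in one order only.\<close>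
  have half: "oct.root_elt t k l \<in> G \<or> (\<forall>t. oct.root_elt t l k \<in> G)"
    if "k \<in> oct.idx" "l \<in> oct.idx" "\<bar>k\<bar> \<noteq> \<bar>l\<bar>" for k l t
    using that pos[of 1 2 3] pos[of 2 3 1] pos[of 3 1 2] neg[of 1 2 3] neg[of 2 3 1] neg[of 3 1 2]
      four[of 1 2 3] four[of 2 3 1] four[of 3 1 2]
    unfolding idx4 by (auto simp: cyc_def)
  have "oct.root_elt t k l \<in> G" if "k \<in> oct.idx" "l \<in> oct.idx" "\<bar>k\<bar> \<noteq> \<bar>l\<bar>" for k l t
    using half[OF that, of t] oct.root_swap[of t k l] by auto
  then have "oct.roots {1..4} \<subseteq> G" by (auto simp: oct.roots_def)
  then show ?thesis
    unfolding oct.Elem_def G_def[symmetric] by (rule G.generate_subset)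
qed

lemma translation_group_eq_Omega:
  "generate (BijGroup UNIV) unit_translations
    = carrier (Omega oct_scale (oct_norm :: 'a::field octonion \<Rightarrow> 'a))"
proof -
  interpret E: permutation_subgroup "oct.Elem {1..4} :: ('a octonion \<Rightarrow> 'a octonion) set"
    by (rule oct.Elem_subgroup)
  show ?thesis
    using Elem_subset_translation_group E.generate_subset[OF unit_translations_subset_Elem]
    by (auto simp: oct.carrier_Omega_eq_Elem)
qed

theorem theorem4p6:
  defines "M \<equiv> octonion_loop :: 'a::field octonion monoid"
  shows "generate (BijGroup UNIV)
           ((\<lambda>a x. a * x) ` carrier M \<union> (\<lambda>a x. x * a) ` carrier M)
         = carrier (Omega oct_scale oct_norm)
       \<and> (\<lambda>f. restrict f (carrier M)) \<in> iso (Omega oct_scale oct_norm) (Mlt M)"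
proof
  let ?\<Omega> = "Omega oct_scale (oct_norm :: 'a octonion \<Rightarrow> 'a)"
  let ?C = "carrier M"
  let ?r = "\<lambda>f :: 'a octonion \<Rightarrow> 'a octonion. restrict f ?C"
  let ?O = "oct.orth :: ('a octonion \<Rightarrow> 'a octonion) set"
  have C: "?C = {a. oct_norm a = 1}" by (simp add: M_def octonion_loop_def)
  have gens: "(\<lambda>a x. a * x) ` ?C \<union> (\<lambda>a x. x * a) ` ?C = unit_translations"
    by (simp add: C unit_translations_def)
  show "generate (BijGroup UNIV) ((\<lambda>a x. a * x) ` ?C \<union> (\<lambda>a x. x * a) ` ?C) = carrier ?\<Omega>"
    by (simp only: gens translation_group_eq_Omega)
  have gens_orth: "unit_translations \<subseteq> ?O"
    using unit_translations_subset_Elem oct.Elem_subset_orth by blast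
  have \<Omega>_orth: "carrier ?\<Omega> \<subseteq> ?O"
    using oct.Elem_subset_orth by (simp add: oct.carrier_Omega_eq_Elem)
  have maps: "f x \<in> ?C \<longleftrightarrow> x \<in> ?C" if "f \<in> ?O" for f x
    using oct.orth_N[OF that] by (simp add: C)
  have r_Bij: "?r f \<in> Bij ?C" if f: "f \<in> ?O" for f
  proof -
    have "bij_betw f ?C ?C"
    proof (rule bij_betw_imageI)
      show "inj_on f ?C" using oct.orth_bij[OF f] by (auto simp: bij_def intro: inj_on_subset)
      have "y \<in> f ` ?C" if "y \<in> ?C" for y
        using that maps[OF f] bij_is_surj[OF oct.orth_bij[OF f]] by (metis imageI surjD)
      then show "f ` ?C = ?C" using maps[OF f] by auto
    qed
    then show ?thesis by (simp add: Bij_def)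
  qed
  have r_comp: "?r (f \<circ> g) = ?r f \<otimes>\<^bsub>BijGroup ?C\<^esub> ?r g" if "f \<in> ?O" "g \<in> ?O" for f g
    using that r_Bij maps by (auto simp: BijGroup_def compose_def)
  interpret hom: group_hom "BijGroup UNIV\<lparr>carrier := ?O\<rparr>" "BijGroup ?C" ?r
  proof (intro group_hom.intro group_hom_axioms.intro homI)
    show "group (BijGroup UNIV\<lparr>carrier := ?O\<rparr>)"
      by (rule subgroup.subgroup_is_group[OF oct.orth.subgroup_H group_BijGroup])
  qed (auto simp: group_BijGroup r_Bij r_comp mult_BijGroup_UNIV oct.orth_bij,
       auto simp: BijGroup_def r_Bij)
  have "left_translation M a = ?r (\<lambda>x. a * x)" "right_translation M a = ?r (\<lambda>x. x * a)" for a
    by (simp_all add: left_translation_def right_translation_def M_def octonion_loop_def)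
  then have "left_translation M ` ?C \<union> right_translation M ` ?C = ?r ` unit_translations"
    by (simp add: gens[symmetric] image_Un image_image)
  then have "carrier (Mlt M) = generate (BijGroup ?C) (?r ` unit_translations)"
    by (simp add: Mlt_def)
  also have "\<dots> = ?r ` generate (BijGroup UNIV) unit_translations"
    using hom.generate_img[of unit_translations] gens_orth
    by (simp add: group.generate_consistent[OF group_BijGroup gens_orth oct.orth.subgroup_H])
  finally have img: "carrier (Mlt M) = ?r ` carrier ?\<Omega>"
    by (simp only: translation_group_eq_Omega)
  have mult_\<Omega>: "f \<otimes>\<^bsub>?\<Omega>\<^esub> g = f \<circ> g" if "f \<in> ?O" "g \<in> ?O" for f g
    using that by (simp add: Omega_def orthogonal_group_def mult_BijGroup_UNIV oct.orth_bij)
  show "?r \<in> iso ?\<Omega> (Mlt M)"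
  proof (rule isoI)
    show "?r \<in> hom ?\<Omega> (Mlt M)"
    proof (rule homI)
      show "?r f \<in> carrier (Mlt M)" if "f \<in> carrier ?\<Omega>" for f using that by (simp add: img)
      show "?r (f \<otimes>\<^bsub>?\<Omega>\<^esub> g) = ?r f \<otimes>\<^bsub>Mlt M\<^esub> ?r g"
        if "f \<in> carrier ?\<Omega>" "g \<in> carrier ?\<Omega>" for f g
      proof -
        have "f \<in> ?O" "g \<in> ?O" using that \<Omega>_orth by auto
        then show ?thesis by (simp add: mult_\<Omega> r_comp Mlt_def)
      qed
    qed
    have "inj_on ?r (carrier ?\<Omega>)"
    proof (rule inj_onI)
      fix f g assume fg: "f \<in> carrier ?\<Omega>" "g \<in> carrier ?\<Omega>" "?r f = ?r g"
      have "f x = g x" if "oct_norm x = 1" for x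
        using fun_cong[OF fg(3), of x] that by (simp add: C)
      then show "f = g"
        using fg \<Omega>_orth by (intro oct.orth_eq_if_eq_on_unit_sphere) auto
    qed
    then show "bij_betw ?r (carrier ?\<Omega>) (carrier (Mlt M))"
      by (simp add: bij_betw_def img)
  qed
qed

end
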